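(* Let $\theta\in H^\infty$ be inner, $n\ge 1$, $G\in (L^\infty)^{n\times n}$, and let $I_n$ be the $n\times n$ identity matrix. The operator $A^\theta_G=P_\theta GP_\theta: (K_\theta)^n\to (K_\theta)^n$ is equivalent after extension to the Toeplitz operator $T_{\mathcal G}:(H^2)^{2n}\to(H^2)^{2n}$ with symbol $$\mathcal G=\begin{pmatrix}\overline\theta I_n & 0\\ G & \theta I_n\end{pmatrix}.$$
   Context: All function spaces are on the unit circle $\mathbb T$; $H^2,H^\infty$ are the Hardy spaces of the unit disc. For $\theta$ inner, $K_\theta=H^2\ominus\theta H^2$, and $P_\theta$ is the orthogonal projection onto $(K_\theta)^n$; $A^\theta_G f=P_\theta(Gf)$ for $f\in(K_\theta)^n$. For a matrix symbol $\mathcal G\in(L^\infty)^{m\times m}$, $T_{\mathcal G}f=P^+(\mathcal Gf)$ on $(H^2)^m$, with $P^+$ the orthogonal projection from $L^2$ onto $H^2$ applied componentwise. Operators $T:X\to\widetilde X$ and $S:Y\to\widetilde Y$ are equivalent after extension if there exist (possibly trivial) Banach spaces $X_0,Y_0$ and invertible bounded linear operators $E:\widetilde Y\oplus Y_0\to\widetilde X\oplus X_0$ and $F:X\oplus X_0\to Y\oplus Y_0$ such that $\begin{pmatrix}T&0\\0&I_{X_0}\end{pmatrix}=E\begin{pmatrix}S&0\\0&I_{Y_0}\end{pmatrix}F$. *)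

theory Defs
  imports "HOL-Probability.Probability"
begin

text \<open>The real inner product of the library is the real part of the complex one, so that the norm,
  the topology and the finite powers of the library apply. The complex inner product is linear in
  the first and conjugate-linear in the second argument.\<close>

class complex_inner = real_inner +
  fixes scaleC :: "complex \<Rightarrow> 'a \<Rightarrow> 'a"  (infixr \<open>*\<^sub>C\<close> 75)
    and cinner :: "'a \<Rightarrow> 'a \<Rightarrow> complex"
  assumes scaleC_add_right: "c *\<^sub>C (x + y) = c *\<^sub>C x + c *\<^sub>C y"
    and scaleC_add_left: "(c + d) *\<^sub>C x = c *\<^sub>C x + d *\<^sub>C x"
    and scaleC_scaleC: "c *\<^sub>C d *\<^sub>C x = (c * d) *\<^sub>C x"
    and scaleC_of_real: "complex_of_real r *\<^sub>C x = r *\<^sub>R x"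
    and cinner_commute: "cinner x y = cnj (cinner y x)"
    and cinner_add_left: "cinner (x + y) z = cinner x z + cinner y z"
    and cinner_scaleC_left: "cinner (c *\<^sub>C x) y = c * cinner x y"
    and inner_eq_Re_cinner: "inner x y = Re (cinner x y)"

instantiation vec :: (complex_inner, finite) complex_inner
begin

definition scaleC_vec_def: "c *\<^sub>C x = (\<chi> i. c *\<^sub>C x $ i)"

definition cinner_vec_def: "cinner x y = (\<Sum>i\<in>UNIV. cinner (x $ i) (y $ i))"

instance
proof
  fix c d :: complex and r :: real and x y z :: "'a ^ 'b"
  show "c *\<^sub>C (x + y) = c *\<^sub>C x + c *\<^sub>C y"
    by (simp add: scaleC_vec_def vec_eq_iff scaleC_add_right)
  show "(c + d) *\<^sub>C x = c *\<^sub>C x + d *\<^sub>C x"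
    by (simp add: scaleC_vec_def vec_eq_iff scaleC_add_left)
  show "c *\<^sub>C d *\<^sub>C x = (c * d) *\<^sub>C x"
    by (simp add: scaleC_vec_def vec_eq_iff scaleC_scaleC)
  show "complex_of_real r *\<^sub>C x = r *\<^sub>R x"
    by (simp add: scaleC_vec_def vec_eq_iff scaleC_of_real)
  show "cinner x y = cnj (cinner y x)"
    unfolding cinner_vec_def cnj_sum by (intro sum.cong refl cinner_commute)
  show "cinner (x + y) z = cinner x z + cinner y z"
    by (simp add: cinner_vec_def cinner_add_left sum.distrib)
  show "cinner (c *\<^sub>C x) y = c * cinner x y"
    by (simp add: cinner_vec_def scaleC_vec_def cinner_scaleC_left sum_distrib_left)
  show "inner x y = Re (cinner x y)"
    by (simp add: cinner_vec_def inner_vec_def inner_eq_Re_cinner)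
qed

end

definition orth_proj :: "'a::complex_inner set \<Rightarrow> 'a \<Rightarrow> 'a" where
  "orth_proj S x = (THE y. y \<in> S \<and> (\<forall>z\<in>S. cinner (x - y) z = 0))"

text \<open>Normalised arc length, as a Borel measure on the plane that is concentrated on the unit
  circle. Thus functions on the circle are functions on the plane whose values off the circle
  are irrelevant.\<close>

definition circle :: "complex measure" where
  "circle = distr (uniform_measure lborel {0..2 * pi}) borel cis"

definition square_integrable :: "(complex \<Rightarrow> complex) \<Rightarrow> bool" where
  "square_integrable f \<longleftrightarrow> f \<in> borel_measurable circle \<and> integrable circle (\<lambda>z. (cmod (f z))\<^sup>2)"

definition L2_rel :: "(complex \<Rightarrow> complex) \<Rightarrow> (complex \<Rightarrow> complex) \<Rightarrow> bool" where
  "L2_rel f g \<longleftrightarrow> square_integrable f \<and> square_integrable g \<and> (AE z in circle. f z = g z)"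

lemma square_integrable_zero: "square_integrable (\<lambda>_. 0)"
  by (simp add: square_integrable_def)

lemma square_integrable_add:
  assumes "square_integrable f" "square_integrable g"
  shows "square_integrable (\<lambda>z. f z + g z)"
proof -
  have m: "f \<in> borel_measurable circle" "g \<in> borel_measurable circle"
    and i: "integrable circle (\<lambda>z. (cmod (f z))\<^sup>2)" "integrable circle (\<lambda>z. (cmod (g z))\<^sup>2)"
    using assms by (auto simp: square_integrable_def)
  have b: "(cmod (a + b))\<^sup>2 \<le> 2 * (cmod a)\<^sup>2 + 2 * (cmod b)\<^sup>2" for a b :: complex
  proof -
    have "(cmod (a + b))\<^sup>2 \<le> (cmod a + cmod b)\<^sup>2"
      by (intro power_mono norm_triangle_ineq) auto
    moreover have "0 \<le> (cmod a - cmod b)\<^sup>2" by simp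
    ultimately show ?thesis by (simp add: power2_eq_square algebra_simps)
  qed
  have "integrable circle (\<lambda>z. 2 * (cmod (f z))\<^sup>2 + 2 * (cmod (g z))\<^sup>2)"
    using i by simp
  then have "integrable circle (\<lambda>z. (cmod (f z + g z))\<^sup>2)"
    by (rule Bochner_Integration.integrable_bound) (use m b in auto)
  then show ?thesis using m by (simp add: square_integrable_def)
qed

lemma square_integrable_mult:
  assumes g: "g \<in> borel_measurable circle" "AE z in circle. cmod (g z) \<le> C"
    and f: "square_integrable f"
  shows "square_integrable (\<lambda>z. g z * f z)"
proof -
  have m: "f \<in> borel_measurable circle" and i: "integrable circle (\<lambda>z. (cmod (f z))\<^sup>2)"
    using f by (auto simp: square_integrable_def)
  have "integrable circle (\<lambda>z. C\<^sup>2 * (cmod (f z))\<^sup>2)"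
    using i by simp
  moreover have "(\<lambda>z. (cmod (g z * f z))\<^sup>2) \<in> borel_measurable circle"
    using m g by measurable
  moreover have "AE z in circle. norm ((cmod (g z * f z))\<^sup>2) \<le> norm (C\<^sup>2 * (cmod (f z))\<^sup>2)"
    using g(2) by eventually_elim
      (auto simp: norm_mult power_mult_distrib intro!: mult_right_mono power_mono)
  ultimately have "integrable circle (\<lambda>z. (cmod (g z * f z))\<^sup>2)"
    by (rule Bochner_Integration.integrable_bound)
  then show ?thesis using m g by (simp add: square_integrable_def)
qed

lemma square_integrable_cmult:
  "square_integrable f \<Longrightarrow> square_integrable (\<lambda>z. c * f z)"
  by (rule square_integrable_mult[where C = "cmod c"]) auto

lemma integrable_mult_cnj:
  assumes "square_integrable f" "square_integrable g"
  shows "integrable circle (\<lambda>z. f z * cnj (g z))"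
proof -
  have m: "f \<in> borel_measurable circle" "g \<in> borel_measurable circle"
    and i: "integrable circle (\<lambda>z. (cmod (f z))\<^sup>2)" "integrable circle (\<lambda>z. (cmod (g z))\<^sup>2)"
    using assms by (auto simp: square_integrable_def)
  have b: "cmod a * cmod b \<le> (cmod a)\<^sup>2 + (cmod b)\<^sup>2" for a b :: complex
  proof -
    have "0 \<le> (cmod a - cmod b)\<^sup>2" "0 \<le> cmod a * cmod b" by simp_all
    then show ?thesis unfolding power2_diff by linarith
  qed
  have "(\<lambda>z. f z * cnj (g z)) \<in> borel_measurable circle"
    by (intro borel_measurable_times m
        measurable_compose[OF m(2) borel_measurable_continuous_onI] continuous_intros)
  then show ?thesis
    by (intro Bochner_Integration.integrable_bound[OF Bochner_Integration.integrable_add[OF i]])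
      (use b in \<open>auto simp: norm_mult\<close>)
qed

quotient_type L2 = "complex \<Rightarrow> complex" / partial: L2_rel
proof (rule part_equivpI)
  show "\<exists>f. L2_rel f f"
    using square_integrable_zero by (auto simp: L2_rel_def)
  show "symp L2_rel"
    by (auto simp: symp_def L2_rel_def)
  show "transp L2_rel"
    unfolding transp_def L2_rel_def by (auto elim: AE_mp)
qed

instantiation L2 :: complex_inner
begin

lift_definition zero_L2 :: L2 is "\<lambda>_. 0"
  by (simp add: L2_rel_def square_integrable_zero)

lift_definition plus_L2 :: "L2 \<Rightarrow> L2 \<Rightarrow> L2" is "\<lambda>f g z. f z + g z"
  by (auto simp: L2_rel_def square_integrable_add)

lift_definition scaleC_L2 :: "complex \<Rightarrow> L2 \<Rightarrow> L2" is "\<lambda>c f z. c * f z"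
  by (auto simp: L2_rel_def square_integrable_cmult)

lift_definition cinner_L2 :: "L2 \<Rightarrow> L2 \<Rightarrow> complex" is "\<lambda>f g. \<integral>z. f z * cnj (g z) \<partial>circle"
proof -
  fix f f' g g' assume a: "L2_rel f f'" "L2_rel g g'"
  show "(\<integral>z. f z * cnj (g z) \<partial>circle) = (\<integral>z. f' z * cnj (g' z) \<partial>circle)"
  proof (rule integral_cong_AE)
    show "AE z in circle. f z * cnj (g z) = f' z * cnj (g' z)"
      using a unfolding L2_rel_def by auto
  qed (use a integrable_mult_cnj in \<open>auto simp: L2_rel_def\<close>)
qed

definition uminus_L2_def: "- (f :: L2) = (-1) *\<^sub>C f"
definition minus_L2_def: "(f :: L2) - g = f + (-1) *\<^sub>C g"
definition scaleR_L2_def: "r *\<^sub>R (f :: L2) = complex_of_real r *\<^sub>C f"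
definition inner_L2_def: "inner (f :: L2) g = Re (cinner f g)"
definition norm_L2_def: "norm (f :: L2) = sqrt (inner f f)"
definition sgn_L2_def: "sgn (f :: L2) = inverse (norm f) *\<^sub>R f"
definition dist_L2_def: "dist (f :: L2) g = norm (f - g)"
definition uniformity_L2_def:
  "(uniformity :: (L2 \<times> L2) filter) = (INF e\<in>{0 <..}. principal {(x, y). dist x y < e})"
definition open_L2_def:
  "open (U :: L2 set) \<longleftrightarrow> (\<forall>x\<in>U. eventually (\<lambda>(x', y). x' = x \<longrightarrow> y \<in> U) uniformity)"

instance
proof
  fix a b c :: L2 and x y :: complex and r s :: real
  show A: "a + b + c = a + (b + c)"
    by transfer (simp add: L2_rel_def add.assoc square_integrable_add)
  show C: "a + b = b + a"
    by transfer (simp add: L2_rel_def add.commute square_integrable_add)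
  show Z: "0 + a = a"
    by transfer (simp add: L2_rel_def)
  show "- a + a = 0"
    unfolding uminus_L2_def
    by transfer (simp add: L2_rel_def square_integrable_zero)
  show "a - b = a + - b"
    by (simp add: minus_L2_def uminus_L2_def)
  have R: "x *\<^sub>C (a + b) = x *\<^sub>C a + x *\<^sub>C b" for x and a b :: L2
    by transfer (simp add: L2_rel_def square_integrable_add square_integrable_cmult ring_distribs)
  have L: "(x + y) *\<^sub>C a = x *\<^sub>C a + y *\<^sub>C a" for x y and a :: L2
    by transfer (simp add: L2_rel_def square_integrable_add square_integrable_cmult ring_distribs)
  have S: "x *\<^sub>C y *\<^sub>C a = (x * y) *\<^sub>C a" for x y and a :: L2
    by transfer (simp add: L2_rel_def square_integrable_cmult mult.assoc)
  show "x *\<^sub>C (a + b) = x *\<^sub>C a + x *\<^sub>C b" "(x + y) *\<^sub>C a = x *\<^sub>C a + y *\<^sub>C a"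
    "x *\<^sub>C y *\<^sub>C a = (x * y) *\<^sub>C a" by (fact R L S)+
  show "complex_of_real r *\<^sub>C a = r *\<^sub>R a"
    by (simp add: scaleR_L2_def)
  show "r *\<^sub>R (a + b) = r *\<^sub>R a + r *\<^sub>R b" "(r + s) *\<^sub>R a = r *\<^sub>R a + s *\<^sub>R a"
    "r *\<^sub>R s *\<^sub>R a = (r * s) *\<^sub>R a"
    by (simp_all add: scaleR_L2_def R L S)
  have O: "1 *\<^sub>C a = a" for a :: L2
    by transfer (simp add: L2_rel_def)
  show "1 *\<^sub>R a = a"
    by (simp add: scaleR_L2_def O)
  show K: "cinner a b = cnj (cinner b a)" for a b :: L2
    by transfer (simp flip: Bochner_Integration.integral_cnj add: mult.commute)
  show D: "cinner (a + b) c = cinner a c + cinner b c"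
    by transfer (simp add: L2_rel_def integrable_mult_cnj ring_distribs)
  show M: "cinner (x *\<^sub>C a) b = x * cinner a b" for x
    by transfer (simp add: mult.assoc)
  show I: "inner a b = Re (cinner a b)" for a b :: L2
    by (simp add: inner_L2_def)
  show "inner a b = inner b a"
    unfolding I by (subst K) simp
  show "inner (a + b) c = inner a c + inner b c"
    by (simp add: I D)
  show "inner (r *\<^sub>R a) b = r * inner a b"
    by (simp add: I scaleR_L2_def M)
  have eq: "Re (\<integral>z. f z * cnj (f z) \<partial>circle) = (\<integral>z. (cmod (f z))\<^sup>2 \<partial>circle)" for f
    by (simp flip: complex_norm_square del: of_real_power)
  show "0 \<le> inner a a"
    unfolding I by transfer (simp add: eq)
  show "inner a a = 0 \<longleftrightarrow> a = 0"
    unfolding I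
  proof transfer
    fix f assume f: "L2_rel f f"
    have "(\<integral>z. (cmod (f z))\<^sup>2 \<partial>circle) = 0 \<longleftrightarrow> (AE z in circle. (cmod (f z))\<^sup>2 = 0)"
      using f by (intro integral_nonneg_eq_0_iff_AE) (auto simp: L2_rel_def square_integrable_def)
    then show "Re (\<integral>z. f z * cnj (f z) \<partial>circle) = 0 \<longleftrightarrow> L2_rel f (\<lambda>_. 0)"
      using f by (simp add: eq L2_rel_def square_integrable_zero)
  qed
  show "norm a = sqrt (inner a a)" "sgn a = inverse (norm a) *\<^sub>R a" "dist a b = norm (a - b)"
    by (fact norm_L2_def sgn_L2_def dist_L2_def)+
  show "uniformity = (INF e\<in>{0 <..}. principal {(x, y :: L2). dist x y < e})"
    by (fact uniformity_L2_def)
  show "open U \<longleftrightarrow> (\<forall>x\<in>U. eventually (\<lambda>(x', y). x' = x \<longrightarrow> y \<in> U) uniformity)" for U :: "L2 set"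
    by (fact open_L2_def)
qed

end

definition Linf :: "(complex \<Rightarrow> complex) set" where
  "Linf = {g \<in> borel_measurable circle. \<exists>C. AE z in circle. cmod (g z) \<le> C}"

text \<open>The class of \<open>g f\<close> for \<open>g\<close> in \<open>L\<^sup>\<infinity>\<close>; for any other \<open>g\<close> the value is a dummy.\<close>

lift_definition mult_L2 :: "(complex \<Rightarrow> complex) \<Rightarrow> L2 \<Rightarrow> L2"
  is "\<lambda>g f. if g \<in> Linf then (\<lambda>z. g z * f z) else (\<lambda>_. 0)"
proof -
  fix g f f' :: "complex \<Rightarrow> complex"
  assume a: "L2_rel f f'"
  show "L2_rel (if g \<in> Linf then \<lambda>z. g z * f z else (\<lambda>_. 0))
    (if g \<in> Linf then \<lambda>z. g z * f' z else (\<lambda>_. 0))"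
  proof (cases "g \<in> Linf")
    case True
    then obtain C where "g \<in> borel_measurable circle" "AE z in circle. cmod (g z) \<le> C"
      by (auto simp: Linf_def)
    with a True show ?thesis
      by (auto simp: L2_rel_def intro: square_integrable_mult)
  qed (simp add: L2_rel_def square_integrable_zero)
qed

definition mult_matrix_L2 :: "(complex \<Rightarrow> complex ^ 'n ^ 'm) \<Rightarrow> L2 ^ 'n \<Rightarrow> L2 ^ 'm" where
  "mult_matrix_L2 G f = (\<chi> i. \<Sum>j\<in>UNIV. mult_L2 (\<lambda>z. G z $ i $ j) (f $ j))"

definition Linf_matrix :: "(complex \<Rightarrow> complex ^ 'n ^ 'm) set" where
  "Linf_matrix = {G. \<forall>i j. (\<lambda>z. G z $ i $ j) \<in> Linf}"

text \<open>The Hardy spaces are taken in their boundary-value form: the functions on the circle whose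
  Fourier coefficients of negative index vanish.\<close>

definition fourier_coeff :: "(complex \<Rightarrow> complex) \<Rightarrow> int \<Rightarrow> complex" where
  "fourier_coeff f k = (\<integral>z. f z * cnj (z powi k) \<partial>circle)"

lift_definition fourier_coeff_L2 :: "L2 \<Rightarrow> int \<Rightarrow> complex" is fourier_coeff
proof
  fix f g :: "complex \<Rightarrow> complex" and k
  assume a: "L2_rel f g"
  have "(\<lambda>z::complex. z powi k) \<in> borel_measurable borel"
    unfolding power_int_def by measurable
  then have [measurable]: "(\<lambda>z::complex. cnj (z powi k)) \<in> borel_measurable borel"
    by (rule measurable_compose) (intro borel_measurable_continuous_onI continuous_intros)
  have [measurable]: "f \<in> borel_measurable borel" "g \<in> borel_measurable borel"
    using a by (auto simp: L2_rel_def square_integrable_def circle_def)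
  show "fourier_coeff f k = fourier_coeff g k"
    unfolding fourier_coeff_def
  proof (rule integral_cong_AE)
    show "AE z in circle. f z * cnj (z powi k) = g z * cnj (z powi k)"
      using a by (auto simp: L2_rel_def)
  qed (simp_all add: circle_def del: complex_cnj_power_int)
qed

definition H2 :: "L2 set" where
  "H2 = {f. \<forall>k<0. fourier_coeff_L2 f k = 0}"

definition Hinf :: "(complex \<Rightarrow> complex) set" where
  "Hinf = {g \<in> Linf. \<forall>k<0. fourier_coeff g k = 0}"

definition inner_function :: "(complex \<Rightarrow> complex) \<Rightarrow> bool" where
  "inner_function \<theta> \<longleftrightarrow> \<theta> \<in> Hinf \<and> (AE z in circle. cmod (\<theta> z) = 1)"

definition model_space :: "(complex \<Rightarrow> complex) \<Rightarrow> L2 set" where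
  "model_space \<theta> = {f \<in> H2. \<forall>h\<in>H2. cinner f (mult_L2 \<theta> h) = 0}"

definition vec_power :: "'a set \<Rightarrow> ('a ^ 'n) set" where
  "vec_power S = {f. \<forall>i. f $ i \<in> S}"

definition truncated_toeplitz ::
    "(complex \<Rightarrow> complex) \<Rightarrow> (complex \<Rightarrow> complex ^ 'n ^ 'n) \<Rightarrow> L2 ^ 'n \<Rightarrow> L2 ^ 'n" where
  "truncated_toeplitz \<theta> G f = orth_proj (vec_power (model_space \<theta>)) (mult_matrix_L2 G f)"

definition toeplitz :: "(complex \<Rightarrow> complex ^ 'm ^ 'm) \<Rightarrow> L2 ^ 'm \<Rightarrow> L2 ^ 'm" where
  "toeplitz G f = (\<chi> i. orth_proj H2 (mult_matrix_L2 G f $ i))"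

definition block_matrix ::
    "'a ^ 'n ^ 'm \<Rightarrow> 'a ^ 'q ^ 'm \<Rightarrow> 'a ^ 'n ^ 'p \<Rightarrow> 'a ^ 'q ^ 'p \<Rightarrow> 'a ^ ('n + 'q) ^ ('m + 'p)" where
  "block_matrix A B C D = (\<chi> i j. case i of
       Inl a \<Rightarrow> (case j of Inl b \<Rightarrow> A $ a $ b | Inr b \<Rightarrow> B $ a $ b)
     | Inr a \<Rightarrow> (case j of Inl b \<Rightarrow> C $ a $ b | Inr b \<Rightarrow> D $ a $ b))"

record 'a complex_space =
  vcarrier :: "'a set"
  vadd :: "'a \<Rightarrow> 'a \<Rightarrow> 'a"
  vzero :: 'a
  vscale :: "complex \<Rightarrow> 'a \<Rightarrow> 'a"
  vnorm :: "'a \<Rightarrow> real"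

locale complex_banach_space =
  fixes V :: "'a complex_space"
  assumes add_closed: "\<lbrakk>x \<in> vcarrier V; y \<in> vcarrier V\<rbrakk> \<Longrightarrow> vadd V x y \<in> vcarrier V"
    and zero_closed: "vzero V \<in> vcarrier V"
    and scale_closed: "x \<in> vcarrier V \<Longrightarrow> vscale V c x \<in> vcarrier V"
    and add_assoc: "\<lbrakk>x \<in> vcarrier V; y \<in> vcarrier V; z \<in> vcarrier V\<rbrakk>
      \<Longrightarrow> vadd V (vadd V x y) z = vadd V x (vadd V y z)"
    and add_commute: "\<lbrakk>x \<in> vcarrier V; y \<in> vcarrier V\<rbrakk> \<Longrightarrow> vadd V x y = vadd V y x"
    and add_zero: "x \<in> vcarrier V \<Longrightarrow> vadd V x (vzero V) = x"
    and add_inverse: "x \<in> vcarrier V \<Longrightarrow> vadd V x (vscale V (-1) x) = vzero V"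
    and scale_add_right: "\<lbrakk>x \<in> vcarrier V; y \<in> vcarrier V\<rbrakk>
      \<Longrightarrow> vscale V c (vadd V x y) = vadd V (vscale V c x) (vscale V c y)"
    and scale_add_left: "x \<in> vcarrier V
      \<Longrightarrow> vscale V (c + d) x = vadd V (vscale V c x) (vscale V d x)"
    and scale_scale: "x \<in> vcarrier V \<Longrightarrow> vscale V c (vscale V d x) = vscale V (c * d) x"
    and scale_one: "x \<in> vcarrier V \<Longrightarrow> vscale V 1 x = x"
    and norm_nonneg: "x \<in> vcarrier V \<Longrightarrow> 0 \<le> vnorm V x"
    and norm_eq_zero: "x \<in> vcarrier V \<Longrightarrow> vnorm V x = 0 \<longleftrightarrow> x = vzero V"
    and norm_triangle: "\<lbrakk>x \<in> vcarrier V; y \<in> vcarrier V\<rbrakk>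
      \<Longrightarrow> vnorm V (vadd V x y) \<le> vnorm V x + vnorm V y"
    and norm_scale: "x \<in> vcarrier V \<Longrightarrow> vnorm V (vscale V c x) = cmod c * vnorm V x"
    and complete:
      "Metric_space.mcomplete (vcarrier V) (\<lambda>x y. vnorm V (vadd V x (vscale V (-1) y)))"

definition subspace_structure :: "'a::complex_inner set \<Rightarrow> 'a complex_space" where
  "subspace_structure S = \<lparr>vcarrier = S, vadd = (+), vzero = 0, vscale = (*\<^sub>C), vnorm = norm\<rparr>"

definition direct_sum ::
    "'a complex_space \<Rightarrow> 'b complex_space \<Rightarrow> ('a \<times> 'b) complex_space"  (infixr \<open>\<oplus>\<^sub>B\<close> 65) where
  "V \<oplus>\<^sub>B W = \<lparr>vcarrier = vcarrier V \<times> vcarrier W,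
     vadd = (\<lambda>p q. (vadd V (fst p) (fst q), vadd W (snd p) (snd q))),
     vzero = (vzero V, vzero W),
     vscale = (\<lambda>c p. (vscale V c (fst p), vscale W c (snd p))),
     vnorm = (\<lambda>p. vnorm V (fst p) + vnorm W (snd p))\<rparr>"

definition bounded_operator :: "'a complex_space \<Rightarrow> 'b complex_space \<Rightarrow> ('a \<Rightarrow> 'b) \<Rightarrow> bool" where
  "bounded_operator V W T \<longleftrightarrow>
     (\<forall>x\<in>vcarrier V. T x \<in> vcarrier W) \<and>
     (\<forall>x\<in>vcarrier V. \<forall>y\<in>vcarrier V. T (vadd V x y) = vadd W (T x) (T y)) \<and>
     (\<forall>c. \<forall>x\<in>vcarrier V. T (vscale V c x) = vscale W c (T x)) \<and>
     (\<exists>K. \<forall>x\<in>vcarrier V. vnorm W (T x) \<le> K * vnorm V x)"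

definition invertible_operator :: "'a complex_space \<Rightarrow> 'b complex_space \<Rightarrow> ('a \<Rightarrow> 'b) \<Rightarrow> bool" where
  "invertible_operator V W T \<longleftrightarrow> bounded_operator V W T \<and>
     (\<exists>R. bounded_operator W V R \<and>
       (\<forall>x\<in>vcarrier V. R (T x) = x) \<and> (\<forall>y\<in>vcarrier W. T (R y) = y))"

text \<open>Types cannot be quantified existentially, so the Banach spaces \<open>X\<^sub>0\<close> and \<open>Y\<^sub>0\<close> range over all
  Banach spaces, with arbitrary operations and norm, whose points are taken from the type \<open>'u\<close>.
  If \<open>X\<close>, \<open>X'\<close>, \<open>Y\<close>, \<open>Y'\<close> are separable, then \<open>X\<^sub>0\<close> and \<open>Y\<^sub>0\<close> can be replaced by separable closed
  subspaces (close off countable sets under \<open>E\<close>, \<open>F\<close> and their inverses); hence any \<open>'u\<close> with at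
  least continuum many elements yields the unrestricted notion.\<close>

definition equivalent_after_extension :: "'u itself
    \<Rightarrow> 'a complex_space \<Rightarrow> 'b complex_space \<Rightarrow> ('a \<Rightarrow> 'b)
    \<Rightarrow> 'c complex_space \<Rightarrow> 'd complex_space \<Rightarrow> ('c \<Rightarrow> 'd) \<Rightarrow> bool" where
  "equivalent_after_extension _ X X' T Y Y' S \<longleftrightarrow>
     complex_banach_space X \<and> complex_banach_space X' \<and> bounded_operator X X' T \<and>
     complex_banach_space Y \<and> complex_banach_space Y' \<and> bounded_operator Y Y' S \<and>
     (\<exists>(X\<^sub>0 :: 'u complex_space) (Y\<^sub>0 :: 'u complex_space) E F.
        complex_banach_space X\<^sub>0 \<and> complex_banach_space Y\<^sub>0 \<and>
        invertible_operator (Y' \<oplus>\<^sub>B Y\<^sub>0) (X' \<oplus>\<^sub>B X\<^sub>0) E \<and>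
        invertible_operator (X \<oplus>\<^sub>B X\<^sub>0) (Y \<oplus>\<^sub>B Y\<^sub>0) F \<and>
        (\<forall>p\<in>vcarrier (X \<oplus>\<^sub>B X\<^sub>0). map_prod T id p = E (map_prod S id (F p))))"

end

theory Submission
  imports Defs
begin

text \<open>Write \<open>H = (H\<^sup>2)\<^sup>n\<close>, \<open>K = (K\<^sub>\<theta>)\<^sup>n\<close> and \<open>P\<close>, \<open>Q\<close> for the projections onto \<open>H\<close>, \<open>K\<close>.
  Since \<open>H = K \<oplus> \<theta>H\<close> with \<open>Q = P - \<theta>P\<theta>'\<close>, where \<open>\<theta>'\<close> is the conjugate of \<open>\<theta>\<close>, the Toeplitz operator maps
  \<open>(k + \<theta>h, w - P\<theta>'Gk)\<close> to \<open>(h, QGk + PG\<theta>h + \<theta>w)\<close>. Subtracting \<open>PG\<theta>h\<close> from the second component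
  leaves \<open>QGk + \<theta>w\<close>, which splits along \<open>K \<oplus> \<theta>H\<close> into \<open>QGk\<close> and \<open>w\<close>. Hence one can take
  \<open>X\<^sub>0 = H \<oplus> H\<close>, \<open>Y\<^sub>0 = 0\<close>, \<open>F (k, (h, w)) = (k + \<theta>h, w - P\<theta>'Gk)\<close>, and let \<open>E\<close> send \<open>(a, b)\<close> to
  \<open>(Qc, (a, P\<theta>'c))\<close> with \<open>c = b - PG\<theta>a\<close>.

  That \<open>\<theta>\<close> maps \<open>H\<^sup>2\<close> into itself is clear on monomials. It extends to \<open>H\<^sup>2\<close> because the trigonometric
  system is complete: if all Fourier coefficients of \<open>f\<close> vanish, then \<open>f\<close> integrates to zero against
  polynomials, by Stone-Weierstrass against continuous functions, and then against the indicators
  of closed and of Borel sets.\<close>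

section \<open>Complex inner product spaces\<close>

definition closed_csubspace :: "'a::complex_inner set \<Rightarrow> bool" where
  "closed_csubspace S \<longleftrightarrow> 0 \<in> S \<and> (\<forall>x\<in>S. \<forall>y\<in>S. x + y \<in> S) \<and> (\<forall>c. \<forall>x\<in>S. c *\<^sub>C x \<in> S) \<and> closed S"

lemma scaleC_minus_one: "(-1) *\<^sub>C (x::'a::complex_inner) = - x"
  using scaleC_of_real[of "-1" x] by simp

lemma scaleC_one: "1 *\<^sub>C (x::'a::complex_inner) = x"
  using scaleC_of_real[of 1 x] by simp

lemma scaleC_zero_right: "c *\<^sub>C (0::'a::complex_inner) = 0"
  using scaleC_add_right[of c 0 "0::'a"] by simp

lemma scaleC_minus_right: "c *\<^sub>C (- x) = - (c *\<^sub>C (x::'a::complex_inner))"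
  by (metis scaleC_minus_one scaleC_scaleC mult.commute)

lemma scaleC_diff_right: "c *\<^sub>C (x - y) = c *\<^sub>C x - c *\<^sub>C (y::'a::complex_inner)"
  using scaleC_add_right[of c x "- y"] by (simp add: scaleC_minus_right)

lemma cinner_zero_left: "cinner 0 (y::'a::complex_inner) = 0"
  using cinner_add_left[of 0 "0::'a" y] by simp

lemma cinner_minus_left: "cinner (- x) (y::'a::complex_inner) = - cinner x y"
  using cinner_scaleC_left[of "-1" x y] by (simp add: scaleC_minus_one)

lemma cinner_diff_left: "cinner (x - y) (z::'a::complex_inner) = cinner x z - cinner y z"
  using cinner_add_left[of x "-y" z] by (simp add: cinner_minus_left)

lemma cinner_scaleC_right: "cinner x (c *\<^sub>C y::'a::complex_inner) = cnj c * cinner x y"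
  by (metis cinner_commute cinner_scaleC_left complex_cnj_mult)

lemma cinner_self: "cinner x x = complex_of_real ((norm (x::'a::complex_inner))\<^sup>2)"
proof -
  have "Im (cinner x x) = 0"
    using cinner_commute[of x x] by (metis cnj.simps(2) neg_equal_zero)
  then show ?thesis
    by (simp add: complex_eq_iff power2_norm_eq_inner inner_eq_Re_cinner)
qed

lemma cinner_self_eq_zero: "cinner x x = 0 \<longleftrightarrow> (x::'a::complex_inner) = 0"
  by (simp add: cinner_self)

lemma norm_scaleC: "norm (c *\<^sub>C (x::'a::complex_inner)) = cmod c * norm x"
proof -
  have "cinner (c *\<^sub>C x) (c *\<^sub>C x) = c * cnj c * cinner x x"
    by (simp add: cinner_scaleC_left cinner_scaleC_right)
  then have "complex_of_real ((norm (c *\<^sub>C x))\<^sup>2) = complex_of_real ((cmod c * norm x)\<^sup>2)"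
    unfolding cinner_self complex_norm_square[symmetric] by (simp add: power_mult_distrib)
  then have "(norm (c *\<^sub>C x))\<^sup>2 = (cmod c * norm x)\<^sup>2"
    by (simp only: of_real_eq_iff)
  then show ?thesis by (simp add: power2_eq_iff_nonneg)
qed

text \<open>Rotating x by the unimodular scalar c makes the complex inner product real and
  nonnegative, which reduces the claim to the real Cauchy-Schwarz inequality.\<close>

lemma norm_cinner_le: "cmod (cinner x y) \<le> norm x * norm (y::'a::complex_inner)"
proof (cases "cinner x y = 0")
  case False
  define c where "c = cnj (cinner x y) / cmod (cinner x y)"
  have c: "cmod c = 1" using False by (simp add: c_def norm_divide)
  have "cinner (c *\<^sub>C x) y = cmod (cinner x y)"
    using False complex_norm_square[of "cinner x y"]
    by (simp add: cinner_scaleC_left c_def power2_eq_square mult.commute divide_simps)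
  then have "cmod (cinner x y) = inner (c *\<^sub>C x) y" by (simp add: inner_eq_Re_cinner)
  also have "\<dots> \<le> norm (c *\<^sub>C x) * norm y" by (rule norm_cauchy_schwarz)
  finally show ?thesis using c by (simp add: norm_scaleC)
qed simp

lemma continuous_on_cinner_left:
  "continuous_on UNIV (\<lambda>x::'a::complex_inner. cinner x y)"
proof (rule bounded_linear.continuous_on[OF _ continuous_on_id], rule bounded_linear_intro)
  show "cinner (r *\<^sub>R x) y = r *\<^sub>R cinner x y" for r and x :: 'a
    by (simp add: cinner_scaleC_left scaleR_conv_of_real flip: scaleC_of_real)
qed (use norm_cinner_le cinner_add_left in auto)

text \<open>Kernels of continuous functionals are closed, and so are their intersections.
  \<open>H2\<close>, \<open>model_space\<close> and the preimage of \<open>H2\<close> under a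
  multiplication operator are all cut out by such conditions.\<close>

lemma closed_csubspace_orthogonal:
  "closed_csubspace {x::'a::complex_inner. \<forall>y\<in>Y. cinner x y = 0}"
proof -
  have "closed {x::'a. cinner x y = 0}" for y
    using continuous_closed_preimage[OF continuous_on_cinner_left[of y], of "{0}"]
    by (simp add: vimage_def)
  then have "closed (\<Inter>y\<in>Y. {x::'a. cinner x y = 0})" by auto
  moreover have "(\<Inter>y\<in>Y. {x::'a. cinner x y = 0}) = {x. \<forall>y\<in>Y. cinner x y = 0}" by auto
  ultimately show ?thesis
    by (simp add: closed_csubspace_def cinner_zero_left cinner_add_left cinner_scaleC_left)
qed

lemma closed_csubspace_Int:
  "closed_csubspace S \<Longrightarrow> closed_csubspace T \<Longrightarrow> closed_csubspace (S \<inter> T)"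
  by (auto simp: closed_csubspace_def)

lemma closed_csubspaceD:
  assumes "closed_csubspace S"
  shows "0 \<in> S" "x \<in> S \<Longrightarrow> y \<in> S \<Longrightarrow> x + y \<in> S" "x \<in> S \<Longrightarrow> c *\<^sub>C x \<in> S" "closed S"
    "x \<in> S \<Longrightarrow> y \<in> S \<Longrightarrow> x - y \<in> S" "x \<in> S \<Longrightarrow> r *\<^sub>R x \<in> S"
proof -
  show "0 \<in> S" "closed S"
    using assms by (auto simp: closed_csubspace_def)
  show A: "x \<in> S \<Longrightarrow> y \<in> S \<Longrightarrow> x + y \<in> S" for x y
    using assms by (auto simp: closed_csubspace_def)
  show C: "x \<in> S \<Longrightarrow> c *\<^sub>C x \<in> S" for x c
    using assms by (auto simp: closed_csubspace_def)
  show "x \<in> S \<Longrightarrow> y \<in> S \<Longrightarrow> x - y \<in> S"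
    using A[of x "(-1) *\<^sub>C y"] C[of y "-1"] by (simp add: scaleC_minus_one)
  show "x \<in> S \<Longrightarrow> r *\<^sub>R x \<in> S" by (simp add: C flip: scaleC_of_real)
qed

lemma closed_csubspace_vec_power:
  fixes S :: "'a::complex_inner set"
  assumes "closed_csubspace S"
  shows "closed_csubspace (vec_power S :: ('a ^ 'n::finite) set)"
proof -
  have "closed (\<Inter>i. (\<lambda>x :: 'a ^ 'n. x $ i) -` S)"
    by (intro closed_INT ballI closed_vimage_vec_nth closed_csubspaceD[OF assms])
  moreover have "(\<Inter>i. (\<lambda>x :: 'a ^ 'n. x $ i) -` S) = vec_power S"
    by (auto simp: vec_power_def)
  ultimately have "closed (vec_power S :: ('a ^ 'n) set)" by simp
  then show ?thesis
    using closed_csubspaceD[OF assms] by (simp add: closed_csubspace_def vec_power_def scaleC_vec_def)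
qed

section \<open>Bounded complex-linear maps\<close>

text \<open>Everywhere-defined counterpart of \<open>bounded_operator\<close>: on whole types, sums
  and compositions carry no membership conditions. The restriction to carriers comes last, in
  \<open>bounded_operator_subspace\<close> and \<open>bounded_operator_direct_sum\<close>.\<close>

definition bounded_clinear :: "('a::complex_inner \<Rightarrow> 'b::complex_inner) \<Rightarrow> bool" where
  "bounded_clinear T \<longleftrightarrow> (\<forall>x y. T (x + y) = T x + T y) \<and> (\<forall>c x. T (c *\<^sub>C x) = c *\<^sub>C T x) \<and>
     (\<exists>K. \<forall>x. norm (T x) \<le> K * norm x)"

lemma bounded_clinearI:
  assumes "\<And>x y. T (x + y) = T x + T y" "\<And>c x. T (c *\<^sub>C x) = c *\<^sub>C T x"
    "\<And>x. norm (T x) \<le> K * norm x"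
  shows "bounded_clinear T"
  using assms by (auto simp: bounded_clinear_def)

lemma bounded_clinear_add_eq: "bounded_clinear T \<Longrightarrow> T (x + y) = T x + T y"
  and bounded_clinear_scaleC_eq: "bounded_clinear T \<Longrightarrow> T (c *\<^sub>C x) = c *\<^sub>C T x"
  by (auto simp: bounded_clinear_def)

lemma bounded_clinear_bound:
  assumes "bounded_clinear T"
  obtains K where "K \<ge> 0" "\<And>x. norm (T x) \<le> K * norm x"
proof -
  obtain K where "\<And>x. norm (T x) \<le> K * norm x" using assms by (auto simp: bounded_clinear_def)
  then have "norm (T x) \<le> max K 0 * norm x" for x
    by (rule order_trans) (intro mult_right_mono, auto)
  then show ?thesis using that[of "max K 0"] by simp
qed

lemma bounded_clinear_diff_eq: "bounded_clinear T \<Longrightarrow> T (x - y) = T x - T y"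
  using bounded_clinear_add_eq[of T "x - y" y] by simp

lemma bounded_clinear_zero: "bounded_clinear (\<lambda>x. 0)"
  by (rule bounded_clinearI[where K = 0]) (auto simp: scaleC_zero_right)

lemma bounded_clinear_ident: "bounded_clinear (\<lambda>x. x)"
  by (rule bounded_clinearI[where K = 1]) auto

lemma bounded_clinear_add:
  assumes "bounded_clinear S" "bounded_clinear T"
  shows "bounded_clinear (\<lambda>x. S x + T x)"
proof -
  obtain K where "\<And>x. norm (S x) \<le> K * norm x" using bounded_clinear_bound[OF assms(1)] by blast
  moreover obtain L where "\<And>x. norm (T x) \<le> L * norm x" using bounded_clinear_bound[OF assms(2)] by blast
  ultimately have "norm (S x + T x) \<le> (K + L) * norm x" for x
    by (metis add_mono distrib_right norm_triangle_le)
  then show ?thesis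
    by (intro bounded_clinearI) (auto simp: bounded_clinear_add_eq[OF assms(1)] bounded_clinear_add_eq[OF assms(2)]
        bounded_clinear_scaleC_eq[OF assms(1)] bounded_clinear_scaleC_eq[OF assms(2)] scaleC_add_right)
qed

lemma bounded_clinear_uminus: "bounded_clinear T \<Longrightarrow> bounded_clinear (\<lambda>x. - T x)"
  by (auto simp: bounded_clinear_def scaleC_minus_right)

lemma bounded_clinear_diff:
  "bounded_clinear S \<Longrightarrow> bounded_clinear T \<Longrightarrow> bounded_clinear (\<lambda>x. S x - T x)"
  using bounded_clinear_add[OF _ bounded_clinear_uminus, of S T] by simp

lemma bounded_clinear_sum:
  assumes "\<And>i. i \<in> I \<Longrightarrow> bounded_clinear (T i)"
  shows "bounded_clinear (\<lambda>x. \<Sum>i\<in>I. T i x)"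
  using assms
  by (induction I rule: infinite_finite_induct) (auto intro: bounded_clinear_zero bounded_clinear_add)

lemma bounded_clinear_compose:
  assumes "bounded_clinear S" "bounded_clinear T"
  shows "bounded_clinear (\<lambda>x. S (T x))"
proof -
  obtain K where K: "K \<ge> 0" "\<And>x. norm (S x) \<le> K * norm x"
    using bounded_clinear_bound[OF assms(1)] by blast
  obtain L where L: "\<And>x. norm (T x) \<le> L * norm x" using bounded_clinear_bound[OF assms(2)] by blast
  have "norm (S (T x)) \<le> (K * L) * norm x" for x
    using K(2)[of "T x"] mult_left_mono[OF L[of x] K(1)] by (simp add: mult.assoc)
  then show ?thesis
    by (intro bounded_clinearI) (auto simp: bounded_clinear_add_eq[OF assms(1)] bounded_clinear_add_eq[OF assms(2)]
        bounded_clinear_scaleC_eq[OF assms(1)] bounded_clinear_scaleC_eq[OF assms(2)])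
qed

lemma bounded_clinear_component: "bounded_clinear (\<lambda>x::'a::complex_inner ^ 'n::finite. x $ i)"
  by (rule bounded_clinearI[where K = 1]) (auto simp: scaleC_vec_def Finite_Cartesian_Product.norm_nth_le)

text \<open>The norm of a vector is at most the sum of the norms of its components, so the bounds of
  the components add up.\<close>

lemma bounded_clinear_vecI:
  fixes T :: "'a::complex_inner \<Rightarrow> 'b::complex_inner ^ 'n::finite"
  assumes "\<And>i. bounded_clinear (\<lambda>x. T x $ i)"
  shows "bounded_clinear T"
proof -
  have "\<exists>K. \<forall>x. norm (T x $ i) \<le> K * norm x" for i
    using assms[of i] by (auto simp: bounded_clinear_def)
  then obtain K where K: "\<And>i x. norm (T x $ i) \<le> K i * norm x" by metis
  have "norm (T x) \<le> (\<Sum>i\<in>UNIV. K i) * norm x" for x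
  proof -
    have "norm (T x) \<le> (\<Sum>i\<in>UNIV. norm (T x $ i))"
      unfolding norm_vec_def by (rule L2_set_le_sum) auto
    also have "\<dots> \<le> (\<Sum>i\<in>UNIV. K i * norm x)" by (intro sum_mono K)
    finally show ?thesis by (simp add: sum_distrib_right)
  qed
  then show ?thesis
    by (intro bounded_clinearI) (auto simp: vec_eq_iff scaleC_vec_def bounded_clinear_add_eq[OF assms]
        bounded_clinear_scaleC_eq[OF assms])
qed

section \<open>Orthogonal projections\<close>

text \<open>Subtracting from w its projection onto z lowers the squared norm by (inner w z)^2 /
  inner z z, so a minimal w has no component along z.\<close>

lemma minimizer_orthogonal:
  fixes w z :: "'a::real_inner"
  assumes "\<And>t. norm w \<le> norm (w - t *\<^sub>R z)"
  shows "inner w z = 0"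
proof (rule ccontr)
  assume ne: "inner w z \<noteq> 0"
  then have z: "z \<noteq> 0" by auto
  define t where "t = inner w z / inner z z"
  have "inner w w \<le> (norm (w - t *\<^sub>R z))\<^sup>2"
    unfolding power2_norm_eq_inner[symmetric] by (intro power_mono assms) auto
  also have "\<dots> = inner w w - 2 * t * inner w z + t * t * inner z z"
    by (simp add: power2_norm_eq_inner inner_diff_left inner_diff_right inner_commute algebra_simps)
  also have "\<dots> = inner w w - (inner w z)\<^sup>2 / inner z z"
    using z by (simp add: t_def field_simps power2_eq_square)
  finally have "(inner w z)\<^sup>2 / inner z z \<le> 0" by simp
  moreover have "(inner w z)\<^sup>2 / inner z z > 0" using ne z by simp
  ultimately show False by simp
qed

text \<open>A sequence in S whose distances to x tend to the infimum d is Cauchy by the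
  parallelogram law, and its limit is a nearest point.\<close>

lemma nearest_point_exists:
  fixes S :: "'a::{real_inner, complete_space} set"
  assumes S: "closed S" "convex S" "S \<noteq> {}"
  shows "\<exists>y\<in>S. \<forall>z\<in>S. norm (x - y) \<le> norm (x - z)"
proof -
  define d where "d = (INF z\<in>S. norm (x - z))"
  have bdd: "bdd_below ((\<lambda>z. norm (x - z)) ` S)" by (intro bdd_belowI[of _ 0]) auto
  have d_le: "d \<le> norm (x - z)" if "z \<in> S" for z
    unfolding d_def using that by (intro cINF_lower bdd)
  have d0: "0 \<le> d" unfolding d_def using S by (intro cINF_greatest) auto
  have "\<exists>z\<in>S. norm (x - z) < d + inverse (Suc n)" for n
    using cINF_less_iff[OF S(3) bdd, of "d + inverse (Suc n)"] by (simp add: d_def)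
  then obtain s where s: "\<And>n. s n \<in> S" "\<And>n. norm (x - s n) < d + inverse (Suc n)" by metis
  have lim: "(\<lambda>n. norm (x - s n)) \<longlonglongrightarrow> d"
  proof (rule tendsto_sandwich[where f = "\<lambda>_. d"])
    show "(\<lambda>n. d + inverse (real (Suc n))) \<longlonglongrightarrow> d"
      using tendsto_add[OF tendsto_const[of d] LIMSEQ_inverse_real_of_nat] by simp
    show "\<forall>\<^sub>F n in sequentially. norm (x - s n) \<le> d + inverse (real (Suc n))"
      using s(2) by (intro always_eventually allI less_imp_le)
  qed (use d_le s in auto)
  then have lim2: "(\<lambda>n. (norm (x - s n))\<^sup>2) \<longlonglongrightarrow> d\<^sup>2" by (rule tendsto_power)
  have par: "(norm (s m - s n))\<^sup>2 \<le> 2 * (norm (x - s m))\<^sup>2 + 2 * (norm (x - s n))\<^sup>2 - 4 * d\<^sup>2" for m n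
  proof -
    \<comment> \<open>By convexity the midpoint lies in S, so its distance to x is at least d; this
      is where the term 4 d^2 comes from.\<close>
    have "(1/2) *\<^sub>R s m + (1/2) *\<^sub>R s n \<in> S" using S(2) s(1) by (intro convexD) auto
    then have "d\<^sup>2 \<le> (norm (x - ((1/2) *\<^sub>R s m + (1/2) *\<^sub>R s n)))\<^sup>2"
      using d0 d_le by (intro power_mono) auto
    also have "4 * \<dots> = 2 * (norm (x - s m))\<^sup>2 + 2 * (norm (x - s n))\<^sup>2 - (norm (s m - s n))\<^sup>2"
      by (simp add: power2_norm_eq_inner inner_diff_left inner_diff_right inner_add_left inner_add_right
          inner_commute algebra_simps)
    finally show ?thesis by simp
  qed
  have "Cauchy s"
  proof (rule metric_CauchyI)
    fix e :: real assume "0 < e"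
    then have "\<forall>\<^sub>F n in sequentially. (norm (x - s n))\<^sup>2 < d\<^sup>2 + e\<^sup>2 / 4"
      by (intro order_tendstoD[OF lim2]) simp
    then obtain N where N: "\<And>n. n \<ge> N \<Longrightarrow> (norm (x - s n))\<^sup>2 < d\<^sup>2 + e\<^sup>2 / 4"
      by (auto simp: eventually_sequentially)
    have "dist (s m) (s n) < e" if "m \<ge> N" "n \<ge> N" for m n
    proof -
      have "(norm (s m - s n))\<^sup>2 < e\<^sup>2" using par[of m n] N[OF that(1)] N[OF that(2)] by simp
      then show ?thesis using \<open>0 < e\<close> by (simp add: dist_norm power2_less_imp_less)
    qed
    then show "\<exists>M. \<forall>m\<ge>M. \<forall>n\<ge>M. dist (s m) (s n) < e" by blast
  qed
  then obtain y where y: "s \<longlonglongrightarrow> y" by (auto simp: Cauchy_convergent_iff convergent_def)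
  then have "y \<in> S" using S(1) s(1) by (auto simp: closed_sequential_limits)
  moreover have "norm (x - y) = d"
    by (rule LIMSEQ_unique[OF tendsto_norm[OF tendsto_diff[OF tendsto_const y]] lim])
  ultimately show ?thesis using d_le by auto
qed

text \<open>Uniqueness behind the definite description: the difference of two candidates lies in S
  and is orthogonal to itself.\<close>

lemma orth_proj_eqI:
  assumes S: "closed_csubspace S" and y: "y \<in> S" "\<And>z. z \<in> S \<Longrightarrow> cinner (x - y) z = 0"
  shows "orth_proj S x = y"
  unfolding orth_proj_def
proof (rule the_equality)
  fix y' assume y': "y' \<in> S \<and> (\<forall>z\<in>S. cinner (x - y') z = 0)"
  have "y' - y \<in> S" using S y y' by (simp add: closed_csubspaceD)
  then have "cinner (x - y) (y' - y) - cinner (x - y') (y' - y) = 0" using y y' by simp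
  then have "cinner (y' - y) (y' - y) = 0" by (simp flip: cinner_diff_left)
  then show "y' = y" by (simp add: cinner_self_eq_zero)
qed (use y in simp)

text \<open>The projection is the nearest point of S. Minimality only controls the real part of the
  inner product with z; testing with \<i> z controls the imaginary part.\<close>

lemma
  fixes S :: "'a::{complex_inner, complete_space} set"
  assumes S: "closed_csubspace S"
  shows orth_proj_in: "orth_proj S x \<in> S"
    and orth_proj_orthogonal: "z \<in> S \<Longrightarrow> cinner (x - orth_proj S x) z = 0"
proof -
  have "convex S" "S \<noteq> {}" using closed_csubspaceD[OF S] by (auto simp: convex_def)
  then obtain y where y: "y \<in> S" "\<And>z. z \<in> S \<Longrightarrow> norm (x - y) \<le> norm (x - z)"
    using nearest_point_exists[OF closed_csubspaceD(4)[OF S], of x] by blast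
  have re: "inner (x - y) z = 0" if "z \<in> S" for z
  proof (rule minimizer_orthogonal)
    fix t
    have "y + t *\<^sub>R z \<in> S" using y(1) that by (simp add: closed_csubspaceD[OF S])
    from y(2)[OF this] show "norm (x - y) \<le> norm (x - y - t *\<^sub>R z)" by (simp add: diff_diff_eq)
  qed
  have orth: "cinner (x - y) z = 0" if "z \<in> S" for z
  proof -
    have "Re (cinner (x - y) z) = 0" using re[OF that] by (simp add: inner_eq_Re_cinner)
    moreover have "Re (cinner (x - y) (\<i> *\<^sub>C z)) = 0"
      using re[OF closed_csubspaceD(3)[OF S that]] by (simp add: inner_eq_Re_cinner)
    ultimately show ?thesis by (simp add: cinner_scaleC_right complex_eq_iff)
  qed
  have eq: "orth_proj S x = y" using S y(1) orth by (rule orth_proj_eqI)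
  show "orth_proj S x \<in> S" "z \<in> S \<Longrightarrow> cinner (x - orth_proj S x) z = 0"
    using y(1) orth by (simp_all add: eq)
qed

lemma orth_proj_ident: "closed_csubspace S \<Longrightarrow> x \<in> S \<Longrightarrow> orth_proj S x = x"
  by (rule orth_proj_eqI) (auto simp: cinner_zero_left)

lemma orth_proj_eq_zero:
  "closed_csubspace S \<Longrightarrow> (\<And>z. z \<in> S \<Longrightarrow> cinner x z = 0) \<Longrightarrow> orth_proj S x = 0"
  by (rule orth_proj_eqI) (auto simp: closed_csubspaceD)

lemma norm_orth_proj_le:
  fixes S :: "'a::{complex_inner, complete_space} set"
  assumes S: "closed_csubspace S"
  shows "norm (orth_proj S x) \<le> norm x"
proof -
  let ?y = "orth_proj S x"
  have "inner (x - ?y) ?y = 0"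
    using orth_proj_orthogonal[OF S orth_proj_in[OF S]] by (simp add: inner_eq_Re_cinner)
  then have "(norm ?y)\<^sup>2 = inner x ?y" by (simp add: inner_diff_left power2_norm_eq_inner)
  also have "\<dots> \<le> norm x * norm ?y" by (rule norm_cauchy_schwarz)
  finally show ?thesis by (cases "?y = 0") (auto simp: power2_eq_square)
qed

lemma bounded_clinear_orth_proj:
  fixes S :: "'a::{complex_inner, complete_space} set"
  assumes S: "closed_csubspace S"
  shows "bounded_clinear (orth_proj S)"
  unfolding bounded_clinear_def
proof (intro conjI allI exI[of _ 1])
  note P = closed_csubspaceD[OF S] orth_proj_in[OF S] orth_proj_orthogonal[OF S]
  show "orth_proj S (x + y) = orth_proj S x + orth_proj S y" for x y
  proof (rule orth_proj_eqI[OF S])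
    fix z assume "z \<in> S"
    then have "cinner ((x - orth_proj S x) + (y - orth_proj S y)) z = 0"
      unfolding cinner_add_left using P by simp
    then show "cinner (x + y - (orth_proj S x + orth_proj S y)) z = 0"
      by (simp add: algebra_simps)
  qed (simp add: P)
  show "orth_proj S (c *\<^sub>C x) = c *\<^sub>C orth_proj S x" for c x
    by (rule orth_proj_eqI[OF S]) (simp_all add: P cinner_scaleC_left flip: scaleC_diff_right)
  show "norm (orth_proj S x) \<le> 1 * norm x" for x using norm_orth_proj_le[OF S, of x] by simp
qed

text \<open>The inner product of vectors is the sum over the components, so projecting componentwise
  works. This reconciles \<open>truncated_toeplitz\<close>, which projects in the power, with
  \<open>toeplitz\<close>, which projects each component.\<close>

lemma orth_proj_vec_power:
  fixes S :: "'a::{complex_inner, complete_space} set" and x :: "'a ^ 'n::finite"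
  assumes S: "closed_csubspace S"
  shows "orth_proj (vec_power S) x = (\<chi> i. orth_proj S (x $ i))"
  by (rule orth_proj_eqI[OF closed_csubspace_vec_power[OF S]])
    (auto simp: vec_power_def cinner_vec_def orth_proj_in[OF S] orth_proj_orthogonal[OF S])

section \<open>Banach spaces and operators between them\<close>

lemma complex_banach_space_subspace:
  fixes S :: "'a::{complex_inner, complete_space} set"
  assumes S: "closed_csubspace S"
  shows "complex_banach_space (subspace_structure S)"
proof -
  interpret Metric_space S dist by unfold_locales (auto simp: dist_commute dist_triangle)
  have "mcomplete"
    unfolding mcomplete_def
  proof (intro allI impI)
    fix s assume "MCauchy s"
    then have s: "\<And>n. s n \<in> S" "Cauchy s" by (auto simp: MCauchy_def Cauchy_def)
    then obtain l where "l \<in> S" "s \<longlonglongrightarrow> l"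
      using complete_eq_closed[of S] closed_csubspaceD(4)[OF S] by (auto simp: complete_def)
    then show "\<exists>l. limitin mtopology s l sequentially"
      using s by (auto simp: limitin_metric tendsto_iff)
  qed
  \<comment> \<open>The Banach space axioms express distance through x + (-1) y; it has to be
    recognized as \<open>dist\<close>.\<close>
  moreover have "(\<lambda>x y :: 'a. norm (x + (-1) *\<^sub>C y)) = dist"
    by (simp add: fun_eq_iff scaleC_minus_one dist_norm)
  ultimately show ?thesis
    unfolding complex_banach_space_def subspace_structure_def complex_space.simps
    by (intro conjI allI impI)
      (simp_all add: closed_csubspaceD[OF S] scaleC_add_right scaleC_add_left scaleC_scaleC
        scaleC_minus_one scaleC_one norm_scaleC norm_triangle_ineq add.assoc add.commute)
qed

lemma bounded_operator_subspace:
  assumes "bounded_clinear T" "\<And>x. x \<in> S \<Longrightarrow> T x \<in> S'"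
  shows "bounded_operator (subspace_structure S) (subspace_structure S') T"
  using assms by (auto simp: bounded_operator_def subspace_structure_def bounded_clinear_def)

text \<open>Operators between sums of two spaces as 2 x 2 block matrices. The operators of the
  equivalence and their inverses all have this form.\<close>

lemma bounded_operator_direct_sum:
  assumes A: "bounded_clinear A" and B: "bounded_clinear B"
    and C: "bounded_clinear C" and D: "bounded_clinear D"
    and into: "\<And>x y. x \<in> S1 \<Longrightarrow> y \<in> S2 \<Longrightarrow> A x + B y \<in> S3 \<and> C x + D y \<in> S4"
  shows "bounded_operator (subspace_structure S1 \<oplus>\<^sub>B subspace_structure S2)
    (subspace_structure S3 \<oplus>\<^sub>B subspace_structure S4) (\<lambda>(x, y). (A x + B y, C x + D y))"
proof -
  obtain a where a: "a \<ge> 0" "\<And>x. norm (A x) \<le> a * norm x" using bounded_clinear_bound[OF A] by blast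
  obtain b where b: "b \<ge> 0" "\<And>x. norm (B x) \<le> b * norm x" using bounded_clinear_bound[OF B] by blast
  obtain c where c: "c \<ge> 0" "\<And>x. norm (C x) \<le> c * norm x" using bounded_clinear_bound[OF C] by blast
  obtain d where d: "d \<ge> 0" "\<And>x. norm (D x) \<le> d * norm x" using bounded_clinear_bound[OF D] by blast
  have "norm (A x + B y) + norm (C x + D y) \<le> (a + b + c + d) * (norm x + norm y)" for x y
  proof -
    have "norm (A x + B y) + norm (C x + D y) \<le> a * norm x + b * norm y + (c * norm x + d * norm y)"
      by (intro add_mono norm_triangle_le a b c d)
    also have "\<dots> \<le> \<dots> + (b * norm x + d * norm x + a * norm y + c * norm y)"
      using a b c d by simp
    also have "\<dots> = (a + b + c + d) * (norm x + norm y)" by (simp add: algebra_simps)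
    finally show ?thesis .
  qed
  then show ?thesis
    unfolding bounded_operator_def direct_sum_def subspace_structure_def complex_space.simps
    by (auto simp: into scaleC_add_right bounded_clinear_add_eq[OF A] bounded_clinear_add_eq[OF B]
        bounded_clinear_add_eq[OF C] bounded_clinear_add_eq[OF D] bounded_clinear_scaleC_eq[OF A]
        bounded_clinear_scaleC_eq[OF B] bounded_clinear_scaleC_eq[OF C] bounded_clinear_scaleC_eq[OF D]
        add_ac)
qed

section \<open>The circle\<close>

lemma sets_circle [measurable_cong]: "sets circle = sets borel"
  by (simp add: circle_def)

lemma cis_measurable [measurable]: "cis \<in> borel_measurable borel"
  by (intro borel_measurable_continuous_onI continuous_intros)

interpretation circle: prob_space circle
proof -
  interpret u: prob_space "uniform_measure lborel {0..2 * pi}"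
    by (rule prob_space_uniform_measure) simp_all
  show "prob_space circle"
    unfolding circle_def by (rule u.prob_space_distr) measurable
qed

text \<open>\<open>circle\<close> is a measure on the whole plane, so identities that need |z| = 1
  enter integrals through this fact.\<close>

lemma AE_circle: "AE z in circle. cmod z = 1"
  unfolding circle_def by (subst AE_distr_iff) auto

text \<open>Rewrites the integral with the density 1 / (2 pi) on [0, 2 pi], so that the fundamental
  theorem of calculus applies.\<close>

lemma integral_circle:
  fixes f :: "complex \<Rightarrow> complex"
  assumes [measurable]: "f \<in> borel_measurable borel"
  shows "(\<integral>z. f z \<partial>circle) = (\<integral>t. (indicator {0..2 * pi} t / (2 * pi)) *\<^sub>R f (cis t) \<partial>lborel)"
proof -
  have "(\<integral>z. f z \<partial>circle) = (\<integral>t. f (cis t) \<partial>uniform_measure lborel {0..2 * pi})"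
    unfolding circle_def by (rule integral_distr) simp_all
  also have "uniform_measure lborel {0..2 * pi}
      = density lborel (\<lambda>t. ennreal (indicator {0..2 * pi} t / (2 * pi)))"
    unfolding uniform_measure_def using divide_ennreal[of 1 "2 * pi"]
    by (intro density_cong) (auto split: split_indicator)
  also have "(\<integral>t. f (cis t) \<partial>\<dots>) = (\<integral>t. (indicator {0..2 * pi} t / (2 * pi)) *\<^sub>R f (cis t) \<partial>lborel)"
    by (rule integral_density) auto
  finally show ?thesis .
qed

lemma measurable_powi [measurable]: "(\<lambda>z::complex. z powi k) \<in> borel_measurable borel"
  unfolding power_int_def by measurable

lemma measurable_cnj [measurable]: "cnj \<in> borel_measurable borel"
  by (intro borel_measurable_continuous_onI continuous_intros)

lemma cnj_powi_unit:
  assumes "cmod z = 1"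
  shows "cnj (z powi k) = z powi (- k)"
proof -
  have "z * cnj z = 1" using complex_norm_square[of z] assms by simp
  then have "cnj z = inverse z" by (simp add: inverse_unique)
  then show ?thesis by (simp add: power_int_inverse power_int_minus)
qed

text \<open>For nonzero k the antiderivative cis (k t) / (2 pi \<i> k) takes the same value at both
  ends of [0, 2 pi].\<close>

lemma integral_circle_powi: "(\<integral>z. z powi k \<partial>circle) = (if k = 0 then 1 else 0)"
proof (cases "k = 0")
  case False
  have "(\<integral>z. z powi k \<partial>circle)
      = (\<integral>t. (indicator {0..2 * pi} t / (2 * pi)) *\<^sub>R (cis t powi k) \<partial>lborel)"
    by (rule integral_circle) simp
  also have "\<dots> = (\<integral>t. indicator {0..2 * pi} t *\<^sub>R (cis (k * t) / (2 * pi)) \<partial>lborel)"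
    by (intro Bochner_Integration.integral_cong)
      (auto simp: cis_power_int scaleR_conv_of_real mult.commute split: split_indicator)
  also have "\<dots> = cis (k * (2 * pi)) / (2 * pi * \<i> * k) - cis (real_of_int k * 0) / (2 * pi * \<i> * k)"
  proof (rule integral_FTC_Icc[where F = "\<lambda>t. cis (k * t) / (2 * pi * \<i> * k)"])
    show "((\<lambda>t. cis (k * t) / (2 * pi * \<i> * k)) has_vector_derivative cis (k * x) / (2 * pi))
        (at x within {0..2 * pi})" for x :: real
    proof -
      have "((\<lambda>t. cis (k * t)) has_vector_derivative k * \<i> * cis (k * x)) (at x within {0..2 * pi})"
        unfolding has_vector_derivative_complex_iff by (auto intro!: derivative_eq_intros)
      from has_vector_derivative_divide[OF this, of "2 * pi * \<i> * k"] show ?thesis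
        using False by (simp add: field_simps)
    qed
    show "continuous_on {0..2 * pi} (\<lambda>t. cis (k * t) / (2 * pi))"
      by (intro continuous_intros) auto
  qed simp
  also have "\<dots> = 0"
    using cis_multiple_2pi[of "of_int k"] by (simp add: mult.commute)
  finally show ?thesis using False by simp
qed (simp add: circle.prob_space)

section \<open>The space $L^2$\<close>

lemma norm_L2_eq: "(norm f)\<^sup>2 = Re (cinner f (f :: L2))"
  by (simp add: power2_norm_eq_inner inner_eq_Re_cinner)

lemma L2_cases:
  obtains F where "f = abs_L2 F" "square_integrable F"
proof -
  have "abs_L2 (rep_L2 f) = f" by (rule Quotient_abs_rep[OF Quotient_L2])
  moreover have "square_integrable (rep_L2 f)"
    using Quotient_rep_reflp[OF Quotient_L2, of f] by (simp add: L2_rel_def)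
  ultimately show ?thesis using that by metis
qed

lemma L2_rel_refl: "square_integrable F \<Longrightarrow> L2_rel F F"
  by (simp add: L2_rel_def)

lemma abs_L2_eq_iff:
  assumes "square_integrable F" "square_integrable G"
  shows "abs_L2 F = abs_L2 G \<longleftrightarrow> (AE z in circle. F z = G z)"
  using Quotient_rel[OF Quotient_L2, of F G] assms by (auto simp: L2_rel_def)

lemma abs_L2_diff:
  assumes "square_integrable F" "square_integrable G"
  shows "abs_L2 F - abs_L2 G = abs_L2 (\<lambda>z. F z - G z)"
proof -
  have "square_integrable (\<lambda>z. - 1 * G z)" by (rule square_integrable_cmult[OF assms(2)])
  then show ?thesis
    unfolding minus_L2_def
    using assms plus_L2.abs_eq[of F "\<lambda>z. - 1 * G z"] scaleC_L2.abs_eq[of G "- 1"]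
    by (simp add: L2_rel_refl)
qed

lemma square_integrable_diff:
  "square_integrable F \<Longrightarrow> square_integrable G \<Longrightarrow> square_integrable (\<lambda>z. F z - G z)"
  using square_integrable_add[OF _ square_integrable_cmult[of G "-1"], of F] by simp

lemma cinner_abs_L2:
  "square_integrable F \<Longrightarrow> square_integrable G \<Longrightarrow>
    cinner (abs_L2 F) (abs_L2 G) = (\<integral>z. F z * cnj (G z) \<partial>circle)"
  by (simp add: cinner_L2.abs_eq L2_rel_refl)

lemma norm_abs_L2:
  assumes "square_integrable F"
  shows "(norm (abs_L2 F))\<^sup>2 = (\<integral>z. (cmod (F z))\<^sup>2 \<partial>circle)"
  unfolding norm_L2_eq
  by (simp add: cinner_abs_L2 assms del: of_real_power flip: complex_norm_square)

lemma nn_integral_abs_L2: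
  assumes "square_integrable F"
  shows "(\<integral>\<^sup>+z. ennreal ((cmod (F z))\<^sup>2) \<partial>circle) = ennreal ((norm (abs_L2 F))\<^sup>2)"
  unfolding norm_abs_L2[OF assms]
  using assms by (intro nn_integral_eq_integral) (auto simp: square_integrable_def)

lemma square_integrable_const: "square_integrable (\<lambda>_. c)"
  by (simp add: square_integrable_def)

lemma integrable_square_integrable:
  assumes "square_integrable F"
  shows "integrable circle F"
  using integrable_mult_cnj[OF assms square_integrable_const[of 1]] by simp

text \<open>Nonnegativity of the variance of |F| on a probability space. It turns Cauchy sequences
  in \<open>L2\<close> into Cauchy sequences in L^1.\<close>

lemma integral_norm_le_norm_L2:
  assumes F: "square_integrable F"
  shows "(\<integral>z. cmod (F z) \<partial>circle) \<le> norm (abs_L2 F)"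
proof -
  have i: "integrable circle (\<lambda>z. cmod (F z))" "integrable circle (\<lambda>z. (cmod (F z))\<^sup>2)"
    using integrable_square_integrable[OF F] F by (auto simp: square_integrable_def)
  have "0 \<le> circle.variance (\<lambda>z. cmod (F z))" by (rule circle.variance_positive)
  then have "(\<integral>z. cmod (F z) \<partial>circle)\<^sup>2 \<le> (norm (abs_L2 F))\<^sup>2"
    unfolding circle.variance_eq[OF i] norm_abs_L2[OF F] by simp
  then show ?thesis by (rule power2_le_imp_le) simp
qed

text \<open>Riesz-Fischer: the sequence is also Cauchy in L^1, so a subsequence converges almost
  everywhere to some F, and Fatou's lemma bounds the distance from \<open>s n\<close> to F by the
  Cauchy tail.\<close>

lemma Cauchy_imp_convergent_L2:
  fixes s :: "nat \<Rightarrow> L2"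
  assumes "Cauchy s"
  shows "convergent s"
proof -
  have "\<exists>F. s n = abs_L2 F \<and> square_integrable F" for n by (rule L2_cases) blast
  then obtain S where S: "\<And>n. s n = abs_L2 (S n)" "\<And>n. square_integrable (S n)" by metis
  have [measurable]: "S n \<in> borel_measurable circle" for n
    using S(2) by (simp add: square_integrable_def)
  have norm_s: "norm (s m - s n) = norm (abs_L2 (\<lambda>z. S m z - S n z))" for m n
    by (simp add: S abs_L2_diff)
  have "\<exists>N. \<forall>i\<ge>N. \<forall>j\<ge>N. (\<integral>z. norm (S i z - S j z) \<partial>circle) < e" if "e > 0" for e
  proof -
    obtain N where N: "\<forall>i\<ge>N. \<forall>j\<ge>N. dist (s i) (s j) < e"
      using metric_CauchyD[OF assms \<open>e > 0\<close>] by blast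
    have "(\<integral>z. norm (S i z - S j z) \<partial>circle) \<le> dist (s i) (s j)" for i j
      unfolding dist_norm norm_s by (intro integral_norm_le_norm_L2 square_integrable_diff S)
    then show ?thesis using N by (meson le_less_trans)
  qed
  then obtain r where r: "strict_mono r" "AE z in circle. Cauchy (\<lambda>i. S (r i) z)"
    using cauchy_L1_AE_cauchy_subseq[of circle S] integrable_square_integrable[OF S(2)] by metis
  define F where "F z = lim (\<lambda>i. S (r i) z)" for z
  have F_meas [measurable]: "F \<in> borel_measurable circle"
    unfolding F_def by (rule borel_measurable_lim_metric) simp
  have lim: "AE z in circle. (\<lambda>i. S (r i) z) \<longlonglongrightarrow> F z"
    using r(2) by eventually_elim (simp add: F_def Cauchy_convergent_iff convergent_LIMSEQ_iff)
  have fatou: "(\<integral>\<^sup>+z. ennreal ((cmod (S n z - F z))\<^sup>2) \<partial>circle) \<le> ennreal (e\<^sup>2)"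
    if "0 < e" and N: "\<And>m. m \<ge> N \<Longrightarrow> norm (s n - s m) < e" for n N e
  proof -
    have "(\<integral>\<^sup>+z. ennreal ((cmod (S n z - F z))\<^sup>2) \<partial>circle)
        = (\<integral>\<^sup>+z. liminf (\<lambda>i. ennreal ((cmod (S n z - S (r i) z))\<^sup>2)) \<partial>circle)"
      using lim
    proof (intro nn_integral_cong_AE, eventually_elim)
      case (elim z)
      then have "(\<lambda>i. ennreal ((cmod (S n z - S (r i) z))\<^sup>2)) \<longlonglongrightarrow> ennreal ((cmod (S n z - F z))\<^sup>2)"
        by (intro tendsto_intros)
      then show ?case by (rule lim_imp_Liminf[symmetric, rotated]) simp
    qed
    also have "\<dots> \<le> liminf (\<lambda>i. \<integral>\<^sup>+z. ennreal ((cmod (S n z - S (r i) z))\<^sup>2) \<partial>circle)"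
      by (rule nn_integral_liminf) simp
    also have "\<dots> = liminf (\<lambda>i. ennreal ((norm (s n - s (r i)))\<^sup>2))"
      by (simp add: nn_integral_abs_L2 S(2) square_integrable_diff norm_s)
    also have "\<dots> \<le> ennreal (e\<^sup>2)"
    proof (rule Liminf_le)
      show "\<forall>\<^sub>F i in sequentially. ennreal ((norm (s n - s (r i)))\<^sup>2) \<le> ennreal (e\<^sup>2)"
        using eventually_ge_at_top[of N]
      proof eventually_elim
        case (elim i)
        then have "r i \<ge> N" using seq_suble[OF r(1), of i] by simp
        then show ?case using N[of "r i"] by (intro ennreal_leI power_mono) auto
      qed
    qed simp
    finally show ?thesis .
  qed
  have tail: "\<exists>N. \<forall>n\<ge>N. square_integrable (\<lambda>z. S n z - F z) \<and>
      norm (abs_L2 (\<lambda>z. S n z - F z)) \<le> e" if "e > 0" for e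
  proof -
    obtain N where N: "\<forall>i\<ge>N. \<forall>j\<ge>N. norm (s i - s j) < e"
      using metric_CauchyD[OF assms \<open>e > 0\<close>] by (auto simp: dist_norm)
    have "square_integrable (\<lambda>z. S n z - F z) \<and> norm (abs_L2 (\<lambda>z. S n z - F z)) \<le> e"
      if "n \<ge> N" for n
    proof -
      have le: "(\<integral>\<^sup>+z. ennreal ((cmod (S n z - F z))\<^sup>2) \<partial>circle) \<le> ennreal (e\<^sup>2)"
        using N that by (intro fatou[OF \<open>e > 0\<close>, of N]) auto
      have "integrable circle (\<lambda>z. (cmod (S n z - F z))\<^sup>2)"
        using le by (intro integrableI_bounded) (auto simp: ennreal_power elim!: le_less_trans)
      then have sq: "square_integrable (\<lambda>z. S n z - F z)" by (simp add: square_integrable_def)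
      then have "(norm (abs_L2 (\<lambda>z. S n z - F z)))\<^sup>2 \<le> e\<^sup>2"
        using le by (simp add: nn_integral_abs_L2)
      then have "norm (abs_L2 (\<lambda>z. S n z - F z)) \<le> e"
        by (rule power2_le_imp_le) (use \<open>e > 0\<close> in simp)
      then show ?thesis using sq by simp
    qed
    then show ?thesis by blast
  qed
  \<comment> \<open>F inherits square integrability as the difference of \<open>S N\<close> and
    \<open>S N - F\<close>.\<close>
  obtain N where "square_integrable (\<lambda>z. S N z - F z)" using tail[of 1] by auto
  from square_integrable_diff[OF S(2)[of N] this] have F: "square_integrable F" by simp
  have "s \<longlonglongrightarrow> abs_L2 F"
  proof (rule metric_LIMSEQ_I)
    fix e :: real assume "0 < e"
    then obtain N where "\<forall>n\<ge>N. norm (abs_L2 (\<lambda>z. S n z - F z)) \<le> e / 2"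
      using tail[of "e / 2"] by auto
    then have "\<forall>n\<ge>N. dist (s n) (abs_L2 F) \<le> e / 2" by (simp add: dist_norm S abs_L2_diff F)
    then have "\<forall>n\<ge>N. dist (s n) (abs_L2 F) < e" using \<open>0 < e\<close> by force
    then show "\<exists>N. \<forall>n\<ge>N. dist (s n) (abs_L2 F) < e" by blast
  qed
  then show ?thesis by (auto simp: convergent_def)
qed

instance L2 :: complete_space
  by standard (rule Cauchy_imp_convergent_L2)

section \<open>Multiplication operators\<close>

lemma Linf_cnj: "g \<in> Linf \<Longrightarrow> (\<lambda>z. cnj (g z)) \<in> Linf"
  unfolding Linf_def by (auto intro: measurable_compose[OF _ measurable_cnj])

lemma Linf_const: "(\<lambda>_. c) \<in> Linf"
  unfolding Linf_def by (auto intro: exI[of _ "cmod c"])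

lemma Linf_unit:
  "g \<in> borel_measurable circle \<Longrightarrow> AE z in circle. cmod (g z) = 1 \<Longrightarrow> g \<in> Linf"
  unfolding Linf_def by (auto intro!: exI[of _ 1] elim: AE_mp)

lemma Linf_powi: "(\<lambda>z. z powi k) \<in> Linf"
  using AE_circle by (intro Linf_unit) (auto simp: norm_power_int elim: AE_mp)

lemma Linf_square_integrable:
  "g \<in> Linf \<Longrightarrow> square_integrable F \<Longrightarrow> square_integrable (\<lambda>z. g z * F z)"
  by (auto simp: Linf_def intro: square_integrable_mult)

lemma mult_abs_L2:
  "g \<in> Linf \<Longrightarrow> square_integrable F \<Longrightarrow> mult_L2 g (abs_L2 F) = abs_L2 (\<lambda>z. g z * F z)"
  by (simp add: mult_L2.abs_eq L2_rel_refl)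

lemma bounded_clinear_mult_L2:
  assumes g: "g \<in> Linf"
  shows "bounded_clinear (mult_L2 g)"
proof -
  obtain C where C: "AE z in circle. cmod (g z) \<le> C" using g by (auto simp: Linf_def)
  have [measurable]: "g \<in> borel_measurable circle" using g by (simp add: Linf_def)
  show ?thesis
  proof (rule bounded_clinearI)
    show "mult_L2 g (x + y) = mult_L2 g x + mult_L2 g y" for x y
      using g by transfer (auto simp: L2_rel_def algebra_simps intro!: Linf_square_integrable square_integrable_add)
    show "mult_L2 g (c *\<^sub>C x) = c *\<^sub>C mult_L2 g x" for c x
      using g by transfer (auto simp: L2_rel_def algebra_simps intro!: Linf_square_integrable square_integrable_cmult)
    show "norm (mult_L2 g x) \<le> \<bar>C\<bar> * norm x" for x
    proof -
      obtain F where F: "x = abs_L2 F" "square_integrable F" by (rule L2_cases)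
      have "(norm (mult_L2 g x))\<^sup>2 = (\<integral>z. (cmod (g z * F z))\<^sup>2 \<partial>circle)"
        using F g by (simp add: mult_abs_L2 norm_abs_L2 Linf_square_integrable)
      also have "\<dots> \<le> (\<integral>z. \<bar>C\<bar>\<^sup>2 * (cmod (F z))\<^sup>2 \<partial>circle)"
      proof (rule integral_mono_AE)
        show "AE z in circle. (cmod (g z * F z))\<^sup>2 \<le> \<bar>C\<bar>\<^sup>2 * (cmod (F z))\<^sup>2"
          using C by eventually_elim
            (auto simp: norm_mult power_mult_distrib power2_abs intro!: mult_right_mono power_mono)
      qed (use F Linf_square_integrable[OF g F(2)] in \<open>auto simp: square_integrable_def\<close>)
      also have "\<dots> = (\<bar>C\<bar> * norm x)\<^sup>2" by (simp add: F norm_abs_L2 power_mult_distrib)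
      finally show ?thesis by (rule power2_le_imp_le) simp
    qed
  qed
qed

lemma cinner_mult_L2:
  assumes "g \<in> Linf"
  shows "cinner (mult_L2 g x) y = cinner x (mult_L2 (\<lambda>z. cnj (g z)) y)"
  using assms Linf_cnj[OF assms] by transfer (simp add: mult.assoc mult.left_commute)

lemma mult_L2_unimodular:
  assumes "g \<in> Linf" "h \<in> Linf" "AE z in circle. g z * h z = 1"
  shows "mult_L2 g (mult_L2 h x) = x"
proof -
  obtain F where F: "x = abs_L2 F" "square_integrable F" by (rule L2_cases)
  have "AE z in circle. g z * (h z * F z) = F z"
    using assms(3) by eventually_elim (simp flip: mult.assoc)
  then show ?thesis
    using assms F by (simp add: mult_abs_L2 Linf_square_integrable abs_L2_eq_iff)
qed

lemma mult_L2_zero: "mult_L2 (\<lambda>_. 0) x = 0"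
  by transfer (auto simp: L2_rel_def square_integrable_zero)

section \<open>Completeness of the trigonometric system\<close>

lift_definition monomial :: "int \<Rightarrow> L2" is "\<lambda>k z. z powi k"
  using Linf_square_integrable[OF Linf_powi square_integrable_const[of 1]] by (simp add: L2_rel_def)

lemma square_integrable_powi: "square_integrable (\<lambda>z. z powi k)"
  using Linf_square_integrable[OF Linf_powi square_integrable_const[of 1]] by simp

lemma fourier_coeff_eq_cinner: "fourier_coeff_L2 f k = cinner f (monomial k)"
  by transfer (simp add: fourier_coeff_def)

lemma mult_L2_powi_monomial: "mult_L2 (\<lambda>z. z powi j) (monomial k) = monomial (j + k)"
proof -
  have "AE z in circle. z powi j * z powi k = z powi (j + k)"
    using AE_circle
  proof eventually_elim
    case (elim z)
    then have "z \<noteq> 0" by auto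
    then show ?case by (simp add: power_int_add)
  qed
  then show ?thesis
    by (simp add: monomial.abs_eq mult_abs_L2 Linf_powi square_integrable_powi abs_L2_eq_iff
        Linf_square_integrable)
qed

text \<open>The matrix of a multiplication operator in the monomials depends on j - k only; for g in
  \<open>Hinf\<close> it is lower triangular.\<close>

lemma cinner_mult_L2_monomial:
  assumes "g \<in> Linf"
  shows "cinner (mult_L2 g (monomial k)) (monomial j) = fourier_coeff g (j - k)"
proof -
  have [measurable]: "g \<in> borel_measurable circle" using assms by (simp add: Linf_def)
  have "AE z in circle. g z * z powi k * cnj (z powi j) = g z * cnj (z powi (j - k))"
    using AE_circle
  proof eventually_elim
    case (elim z)
    then have "z \<noteq> 0" by auto
    with elim show ?case
      by (simp add: cnj_powi_unit mult.assoc flip: power_int_add del: complex_cnj_power_int)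
  qed
  then have "(\<integral>z. g z * z powi k * cnj (z powi j) \<partial>circle) = (\<integral>z. g z * cnj (z powi (j - k)) \<partial>circle)"
    by (intro integral_cong_AE) (auto simp del: complex_cnj_power_int)
  then show ?thesis
    unfolding fourier_coeff_def using assms
    by (simp add: monomial.abs_eq mult_abs_L2 cinner_abs_L2 square_integrable_powi Linf_square_integrable
      del: complex_cnj_power_int)
qed

text \<open>Multiplication by the constant 1 is the identity, so these inner products are the
  Fourier coefficients of the constant 1.\<close>

lemma cinner_monomial: "cinner (monomial j) (monomial k) = (if j = k then 1 else 0)"
proof -
  have "fourier_coeff (\<lambda>_. 1) (k - j) = (\<integral>z. z powi (j - k) \<partial>circle)"
    unfolding fourier_coeff_def
  proof (rule integral_cong_AE)
    show "AE z in circle. 1 * cnj (z powi (k - j)) = z powi (j - k)"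
      using AE_circle by eventually_elim (simp add: cnj_powi_unit del: complex_cnj_power_int)
  qed (simp_all del: complex_cnj_power_int)
  then show ?thesis
    using cinner_mult_L2_monomial[OF Linf_const[of 1], of j k]
      mult_L2_unimodular[OF Linf_const[of 1] Linf_const[of 1], of "monomial j"]
      mult_L2_powi_monomial[of 0 j]
    by (simp add: integral_circle_powi)
qed

text \<open>The functions that completeness has to show to vanish almost everywhere. They are kept
  as representatives rather than classes, so that they can be multiplied and integrated
  pointwise.\<close>

definition fourier_null :: "(complex \<Rightarrow> complex) \<Rightarrow> bool" where
  "fourier_null F \<longleftrightarrow> square_integrable F \<and> (\<forall>k. fourier_coeff F k = 0)"

lemma integrable_fourier:
  "square_integrable F \<Longrightarrow> integrable circle (\<lambda>z. F z * cnj (z powi k))"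
  by (rule integrable_mult_cnj[OF _ square_integrable_powi])

lemma fourier_null_add:
  "fourier_null F \<Longrightarrow> fourier_null G \<Longrightarrow> fourier_null (\<lambda>z. F z + G z)"
  by (simp add: fourier_null_def square_integrable_add fourier_coeff_def distrib_right
      integrable_fourier del: complex_cnj_power_int)

lemma fourier_null_cmult: "fourier_null F \<Longrightarrow> fourier_null (\<lambda>z. c * F z)"
  by (simp add: fourier_null_def square_integrable_cmult fourier_coeff_def mult.assoc
      del: complex_cnj_power_int)

text \<open>Multiplication by a power of z shifts the Fourier coefficients.\<close>

lemma fourier_null_powi:
  assumes "fourier_null F"
  shows "fourier_null (\<lambda>z. z powi j * F z)"
proof -
  have F: "square_integrable F" "\<And>k. fourier_coeff F k = 0"
    using assms by (auto simp: fourier_null_def)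
  then have [measurable]: "F \<in> borel_measurable circle" by (simp add: square_integrable_def)
  have "fourier_coeff (\<lambda>z. z powi j * F z) k = fourier_coeff F (k - j)" for k
    unfolding fourier_coeff_def
  proof (rule integral_cong_AE)
    show "AE z in circle. z powi j * F z * cnj (z powi k) = F z * cnj (z powi (k - j))"
      using AE_circle
    proof eventually_elim
      case (elim z)
      then have "z \<noteq> 0" by auto
      with elim show ?case
        using power_int_add[of z "j" "- k"]
        by (simp add: cnj_powi_unit mult_ac del: complex_cnj_power_int)
    qed
  qed (simp_all del: complex_cnj_power_int)
  then show ?thesis
    using F by (simp add: fourier_null_def Linf_square_integrable Linf_powi)
qed

text \<open>Needed for identities that hold only on the unit circle, such as Re z = (z + 1/z) /
  2.\<close>

lemma fourier_null_cong_AE: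
  assumes "fourier_null F" "square_integrable G" "AE z in circle. F z = G z"
  shows "fourier_null G"
proof -
  have F: "square_integrable F" "\<And>k. fourier_coeff F k = 0"
    using assms by (auto simp: fourier_null_def)
  then have [measurable]: "F \<in> borel_measurable circle" "G \<in> borel_measurable circle"
    using assms by (auto simp: square_integrable_def)
  have "fourier_coeff F k = fourier_coeff G k" for k
    unfolding fourier_coeff_def
  proof (rule integral_cong_AE)
    show "AE z in circle. F z * cnj (z powi k) = G z * cnj (z powi k)"
      using assms(3) by eventually_elim simp
  qed (simp_all del: complex_cnj_power_int)
  then show ?thesis using F assms(2) by (simp add: fourier_null_def)
qed

lemma Linf_Re: "(\<lambda>z. complex_of_real (Re z)) \<in> Linf"
  and Linf_Im: "(\<lambda>z. complex_of_real (Im z)) \<in> Linf"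
proof -
  have "AE z in circle. cmod (complex_of_real (Re z)) \<le> 1" "AE z in circle. cmod (complex_of_real (Im z)) \<le> 1"
    using AE_circle by (eventually_elim, metis abs_Re_le_cmod abs_Im_le_cmod norm_of_real)+
  then show "(\<lambda>z. complex_of_real (Re z)) \<in> Linf" "(\<lambda>z. complex_of_real (Im z)) \<in> Linf"
    by (auto simp: Linf_def)
qed

lemma fourier_null_Re:
  assumes "fourier_null F"
  shows "fourier_null (\<lambda>z. complex_of_real (Re z) * F z)"
proof (rule fourier_null_cong_AE)
  show "fourier_null (\<lambda>z. (1/2) * (z powi 1 * F z + z powi (-1) * F z))"
    by (intro fourier_null_cmult fourier_null_add fourier_null_powi assms)
  show "AE z in circle. (1/2) * (z powi 1 * F z + z powi (-1) * F z) = complex_of_real (Re z) * F z"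
    using AE_circle
  proof eventually_elim
    case (elim z)
    have "z powi (-1) = cnj z" using cnj_powi_unit[OF elim, of 1] by simp
    then show ?case using complex_add_cnj[of z] by (simp flip: distrib_right)
  qed
qed (use assms Linf_Re in \<open>simp add: fourier_null_def Linf_square_integrable\<close>)

lemma fourier_null_Im:
  assumes "fourier_null F"
  shows "fourier_null (\<lambda>z. complex_of_real (Im z) * F z)"
proof (rule fourier_null_cong_AE)
  show "fourier_null (\<lambda>z. (- \<i> / 2) * (z powi 1 * F z + (-1) * (z powi (-1) * F z)))"
    by (intro fourier_null_cmult fourier_null_add fourier_null_powi assms)
  show "AE z in circle. (- \<i> / 2) * (z powi 1 * F z + (-1) * (z powi (-1) * F z)) = complex_of_real (Im z) * F z"
    using AE_circle
  proof eventually_elim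
    case (elim z)
    have "z powi (-1) = cnj z" using cnj_powi_unit[OF elim, of 1] by simp
    then have "(- \<i> / 2) * (z powi 1 * F z + (-1) * (z powi (-1) * F z)) = - \<i> / 2 * (z - cnj z) * F z"
      by (simp add: field_simps)
    moreover have "- \<i> / 2 * (z - cnj z) = complex_of_real (Im z)" by (simp add: complex_eq_iff)
    ultimately show ?case by (simp only:)
  qed
qed (use assms Linf_Im in \<open>simp add: fourier_null_def Linf_square_integrable\<close>)

text \<open>A real linear form is a combination of Re and Im. The induction lets F vary because for
  a product the first factor is applied to the second factor times F.\<close>

lemma fourier_null_polynomial:
  assumes "real_polynomial_function p" "fourier_null F"
  shows "fourier_null (\<lambda>z. complex_of_real (p z) * F z)"
  using assms
proof (induction p arbitrary: F rule: real_polynomial_function.induct)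
  case (linear h)
  interpret bounded_linear h by fact
  have expand: "h z = h 1 * Re z + h \<i> * Im z" for z
  proof -
    have "z = Re z *\<^sub>R 1 + Im z *\<^sub>R \<i>" by (simp add: complex_eq_iff)
    then have "h z = h (Re z *\<^sub>R 1 + Im z *\<^sub>R \<i>)" by (rule arg_cong)
    then show ?thesis by (simp only: add scaleR real_scaleR_def mult.commute)
  qed
  have "(\<lambda>z. complex_of_real (h z) * F z)
      = (\<lambda>z. complex_of_real (h 1) * (complex_of_real (Re z) * F z)
        + complex_of_real (h \<i>) * (complex_of_real (Im z) * F z))"
    by (rule ext, subst expand) (simp add: algebra_simps)
  then show ?case
    by (simp only:) (intro fourier_null_add fourier_null_cmult fourier_null_Re fourier_null_Im linear.prems)
next
  case (const c)
  then show ?case by (rule fourier_null_cmult)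
next
  case (add f g)
  from fourier_null_add[OF add.IH(1)[OF add.prems] add.IH(2)[OF add.prems]]
  show ?case by (simp add: distrib_right)
next
  case (mult f g)
  from mult.IH(1)[OF mult.IH(2)[OF mult.prems]]
  show ?case by (simp add: mult.assoc)
qed

text \<open>A polynomial p within e of h on the circle has integral zero against F, so the integral
  against h is at most e times the L^1 norm of F, for every positive e.\<close>

lemma fourier_null_continuous:
  assumes F: "fourier_null F" and h: "continuous_on UNIV (h :: complex \<Rightarrow> real)"
  shows "(\<integral>z. complex_of_real (h z) * F z \<partial>circle) = 0"
proof -
  have sq: "square_integrable F" using F by (simp add: fourier_null_def)
  then have [measurable]: "F \<in> borel_measurable circle" by (simp add: square_integrable_def)
  have iF: "integrable circle F" by (rule integrable_square_integrable[OF sq])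
  have [measurable]: "h \<in> borel_measurable borel" using h by (rule borel_measurable_continuous_onI)
  define L where "L = (\<integral>z. cmod (F z) \<partial>circle)"
  have L: "L \<ge> 0" by (simp add: L_def)
  have "bounded (h ` sphere 0 1)"
    by (intro compact_imp_bounded compact_continuous_image continuous_on_subset[OF h]) auto
  then obtain B where "\<forall>x\<in>h ` sphere 0 1. norm x \<le> B" unfolding bounded_iff by blast
  then have B: "\<bar>h z\<bar> \<le> B" if "cmod z = 1" for z using that by simp
  have ih: "integrable circle (\<lambda>z. complex_of_real (h z) * F z)"
  proof (rule Bochner_Integration.integrable_bound[OF integrable_mult_right[OF integrable_norm[OF iF]]])
    show "AE z in circle. norm (complex_of_real (h z) * F z) \<le> norm (B * norm (F z))"
      using AE_circle
    proof eventually_elim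
      case (elim z)
      have "\<bar>h z\<bar> * norm (F z) \<le> B * norm (F z)" using B[OF elim] by (rule mult_right_mono) simp
      then show ?case by (simp add: norm_mult)
    qed
  qed simp
  have le: "cmod (\<integral>z. complex_of_real (h z) * F z \<partial>circle) \<le> e * L" if "e > 0" for e
  proof -
    have "compact (sphere (0::complex) 1)" "continuous_on (sphere 0 1) h"
      using h by (auto intro: continuous_on_subset)
    then obtain p where p: "real_polynomial_function p" "\<And>z. z \<in> sphere 0 1 \<Longrightarrow> \<bar>h z - p z\<bar> < e"
      using Stone_Weierstrass_real_polynomial_function \<open>e > 0\<close> by blast
    have null: "fourier_null (\<lambda>z. complex_of_real (p z) * F z)"
      by (rule fourier_null_polynomial[OF p(1) F])
    then have "(\<integral>z. complex_of_real (p z) * F z \<partial>circle) = 0"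
      by (auto simp: fourier_null_def fourier_coeff_def dest!: spec[of _ 0])
    moreover have ip: "integrable circle (\<lambda>z. complex_of_real (p z) * F z)"
      using null by (simp add: fourier_null_def integrable_square_integrable)
    ultimately have "(\<integral>z. complex_of_real (h z) * F z \<partial>circle)
        = (\<integral>z. complex_of_real (h z) * F z - complex_of_real (p z) * F z \<partial>circle)"
      using ih by simp
    also have "cmod \<dots> \<le> (\<integral>z. e * cmod (F z) \<partial>circle)"
    proof (rule order_trans[OF integral_norm_bound integral_mono_AE])
      show "AE z in circle. cmod (complex_of_real (h z) * F z - complex_of_real (p z) * F z) \<le> e * cmod (F z)"
        using AE_circle
      proof eventually_elim
        case (elim z)
        have "cmod (complex_of_real (h z) * F z - complex_of_real (p z) * F z) = \<bar>h z - p z\<bar> * cmod (F z)"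
          by (simp add: norm_mult flip: left_diff_distrib of_real_diff)
        also have "\<dots> \<le> e * cmod (F z)" using p(2)[of z] elim by (intro mult_right_mono) auto
        finally show ?case .
      qed
    qed (use ih ip iF in auto)
    finally show ?thesis by (simp add: L_def)
  qed
  have "cmod (\<integral>z. complex_of_real (h z) * F z \<partial>circle) \<le> 0"
  proof (rule field_le_epsilon)
    fix e :: real assume "e > 0"
    \<comment> \<open>The added 1 avoids a division by L, which may be zero.\<close>
    have "cmod (\<integral>z. complex_of_real (h z) * F z \<partial>circle) \<le> e / (L + 1) * L"
      using \<open>e > 0\<close> L by (intro le) simp
    also have "\<dots> \<le> e" using \<open>e > 0\<close> L by (simp add: field_simps)
    finally show "cmod (\<integral>z. complex_of_real (h z) * F z \<partial>circle) \<le> 0 + e" by simp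
  qed
  then show ?thesis by simp
qed

text \<open>The indicator is the pointwise limit of continuous cutoffs that vanish at distance 1/n
  from K; |F| dominates the integrands.\<close>

lemma fourier_null_closed:
  assumes F: "fourier_null F" and K: "closed K"
  shows "(\<integral>z. indicator K z * F z \<partial>circle) = 0"
\<comment> \<open>The distance to the empty set is 0 by convention, so the cutoffs would be
  constantly 1 there.\<close>
proof (cases "K = {}")
  case False
  have sq: "square_integrable F" using F by (simp add: fourier_null_def)
  then have [measurable]: "F \<in> borel_measurable circle" by (simp add: square_integrable_def)
  define h where "h n z = max 0 (1 - real n * infdist z K)" for n z
  have cont: "continuous_on UNIV (h n)" for n
    unfolding h_def by (intro continuous_intros)
  have [measurable]: "h n \<in> borel_measurable borel" "K \<in> sets borel" for n
    using cont K by (auto intro: borel_measurable_continuous_onI)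
  have lim: "(\<lambda>n. h n z) \<longlonglongrightarrow> indicator K z" for z
  proof (cases "z \<in> K")
    case True
    then show ?thesis by (simp add: h_def)
  next
    case z: False
    then have pos: "0 < infdist z K" using in_closed_iff_infdist_zero[OF K False] infdist_nonneg[of z K] by force
    obtain N :: nat where N: "1 / infdist z K < N" using reals_Archimedean2 by blast
    have "h n z = 0" if "n \<ge> N" for n
    proof -
      have "1 < real N * infdist z K" using N pos by (simp add: field_simps)
      also have "\<dots> \<le> real n * infdist z K" using that pos by (intro mult_right_mono) auto
      finally show ?thesis by (simp add: h_def)
    qed
    then show ?thesis
      using z by (intro tendsto_eventually) (auto simp: eventually_sequentially intro!: exI[of _ N])
  qed
  have "(\<lambda>n. \<integral>z. complex_of_real (h n z) * F z \<partial>circle)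
      \<longlonglongrightarrow> (\<integral>z. complex_of_real (indicator K z) * F z \<partial>circle)"
  proof (rule integral_dominated_convergence)
    show "integrable circle (\<lambda>z. cmod (F z))"
      by (intro integrable_norm integrable_square_integrable sq)
    show "AE z in circle. norm (complex_of_real (h n z) * F z) \<le> cmod (F z)" for n
    proof (rule AE_I2)
      fix z
      have "\<bar>h n z\<bar> \<le> 1" by (auto simp: h_def infdist_nonneg)
      then show "norm (complex_of_real (h n z) * F z) \<le> cmod (F z)"
        by (simp add: norm_mult mult_left_le_one_le)
    qed
  qed (auto intro!: tendsto_intros lim)
  then have "(\<integral>z. complex_of_real (indicator K z) * F z \<partial>circle) = 0"
    using fourier_null_continuous[OF F cont] by (simp add: LIMSEQ_const_iff)
  also have "(\<lambda>z. complex_of_real (indicator K z) * F z) = (\<lambda>z. indicator K z * F z)"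
    by (auto simp: fun_eq_iff split: split_indicator)
  finally show ?thesis .
qed simp

text \<open>Dynkin's argument: closed sets are stable under intersection and generate the Borel
  sets, and the sets against which F integrates to zero are stable under complements, because the
  total integral vanishes, and under countable disjoint unions.\<close>

lemma fourier_null_borel:
  assumes F: "fourier_null F" and A: "A \<in> sets borel"
  shows "(\<integral>z. indicator A z * F z \<partial>circle) = 0"
proof -
  have sq: "square_integrable F" using F by (simp add: fourier_null_def)
  have iF: "integrable circle F" by (rule integrable_square_integrable[OF sq])
  have [measurable]: "F \<in> borel_measurable circle" using sq by (simp add: square_integrable_def)
  have borel: "sigma_sets UNIV (Collect closed) = sets (borel :: complex measure)"
    by (simp add: borel_eq_closed)
  have int: "integrable circle (\<lambda>z. indicator A z * F z)" if "A \<in> sets borel" for A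
  proof (rule Bochner_Integration.integrable_bound[OF iF])
    show "(\<lambda>z. indicator A z * F z) \<in> borel_measurable circle" using that by measurable
  qed (auto split: split_indicator)
  have total: "(\<integral>z. F z \<partial>circle) = 0"
    using fourier_null_closed[OF F, of UNIV] by simp
  have "Int_stable (Collect closed :: complex set set)" by (auto simp: Int_stable_def)
  moreover have "Collect closed \<subseteq> Pow (UNIV :: complex set)" by simp
  moreover have "A \<in> sigma_sets UNIV (Collect closed)" using A by (simp add: borel)
  ultimately show ?thesis
  proof (induction rule: sigma_sets_induct_disjoint)
    case (basic A)
    then show ?case using fourier_null_closed[OF F] by simp
  next
    case (compl A)
    have "(\<lambda>z. indicator (UNIV - A) z * F z) = (\<lambda>z. F z - indicator A z * F z)"
      by (auto simp: fun_eq_iff split: split_indicator)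
    then show ?case using compl total iF int[of A] by (simp add: borel)
  next
    case (union A)
    then have A: "A i \<in> sets borel" for i by (auto simp: borel)
    have "(\<lambda>n. \<integral>z. indicator (\<Union>i<n. A i) z * F z \<partial>circle) \<longlonglongrightarrow> (\<integral>z. indicator (\<Union>i. A i) z * F z \<partial>circle)"
    proof (rule integral_dominated_convergence)
      show "integrable circle (\<lambda>z. cmod (F z))" using iF by simp
      show "AE z in circle. (\<lambda>n. indicator (\<Union>i<n. A i) z * F z) \<longlonglongrightarrow> indicator (\<Union>i. A i) z * F z"
        by (intro AE_I2 tendsto_mult tendsto_const LIMSEQ_indicator_UN)
      show "(\<lambda>z. indicator (\<Union>i<n. A i) z * F z) \<in> borel_measurable circle" for n
        using A by measurable
      show "(\<lambda>z. indicator (\<Union>i. A i) z * F z) \<in> borel_measurable circle"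
        using A by measurable
    qed (auto split: split_indicator)
    moreover have "(\<integral>z. indicator (\<Union>i<n. A i) z * F z \<partial>circle) = 0" for n
    proof -
      have "indicator (\<Union>i<n. A i) z = (\<Sum>i<n. indicator (A i) z :: complex)" for z
        using union(1) by (intro indicator_UN_disjoint) (auto simp: disjoint_family_on_def)
      then have "(\<integral>z. indicator (\<Union>i<n. A i) z * F z \<partial>circle)
          = (\<integral>z. (\<Sum>i<n. indicator (A i) z * F z) \<partial>circle)"
        by (simp only: sum_distrib_right)
      also have "\<dots> = (\<Sum>i<n. \<integral>z. indicator (A i) z * F z \<partial>circle)"
        by (rule Bochner_Integration.integral_sum) (rule int[OF A])
      also have "\<dots> = 0" using union(3) by simp
      finally show ?thesis .
    qed
    ultimately show ?case by (simp add: LIMSEQ_const_iff)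
  qed simp
qed

text \<open>Testing on the set where v is positive gives a nonnegative function with integral zero;
  u and -u are both treated this way.\<close>

lemma AE_zero_of_set_integrals:
  fixes u :: "'a \<Rightarrow> real"
  assumes u: "integrable M u" and zero: "\<And>A. A \<in> sets M \<Longrightarrow> (\<integral>z. indicator A z * u z \<partial>M) = 0"
  shows "AE z in M. u z = 0"
proof -
  have nonpos: "AE z in M. v z \<le> 0"
    if v: "integrable M v" and zero: "\<And>A. A \<in> sets M \<Longrightarrow> (\<integral>z. indicator A z * v z \<partial>M) = 0"
    for v :: "'a \<Rightarrow> real"
  proof -
    have [measurable]: "v \<in> borel_measurable M" using v by simp
    define A where "A = {z \<in> space M. v z > 0}"
    have [measurable]: "A \<in> sets M" unfolding A_def by measurable
    have "integrable M (\<lambda>z. indicator A z * v z)"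
      by (rule Bochner_Integration.integrable_bound[OF v]) (auto split: split_indicator)
    moreover have "AE z in M. 0 \<le> indicator A z * v z"
      by (auto simp: A_def split: split_indicator)
    ultimately have "AE z in M. indicator A z * v z = 0"
      using zero[of A] integral_nonneg_eq_0_iff_AE[of M "\<lambda>z. indicator A z * v z"] by simp
    then show ?thesis
      using AE_space by eventually_elim (auto simp: A_def split: split_indicator_asm)
  qed
  have "AE z in M. u z \<le> 0" using u zero by (rule nonpos)
  moreover have "AE z in M. - u z \<le> 0" using u zero by (intro nonpos) auto
  ultimately show ?thesis by eventually_elim simp
qed

lemma fourier_null_AE_zero:
  assumes F: "fourier_null F"
  shows "AE z in circle. F z = 0"
proof -
  have iF: "integrable circle F" using F by (simp add: fourier_null_def integrable_square_integrable)
  then have [measurable]: "F \<in> borel_measurable circle" by simp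
  have int: "integrable circle (\<lambda>z. indicator A z * F z)" if "A \<in> sets borel" for A
  proof (rule Bochner_Integration.integrable_bound[OF iF])
    show "(\<lambda>z. indicator A z * F z) \<in> borel_measurable circle" using that by measurable
  qed (auto split: split_indicator)
  have ind: "indicator A z = complex_of_real (indicator A z)" for A and z :: complex
    by (simp split: split_indicator)
  have "AE z in circle. Re (F z) = 0"
  proof (rule AE_zero_of_set_integrals)
    fix A assume "A \<in> sets circle"
    then have A: "A \<in> sets borel" by (simp add: sets_circle)
    have "(\<integral>z. indicator A z * Re (F z) \<partial>circle) = (\<integral>z. Re (indicator A z * F z) \<partial>circle)"
      by (intro Bochner_Integration.integral_cong) (auto split: split_indicator)
    also have "\<dots> = 0" by (subst integral_Re[OF int[OF A]]) (simp add: fourier_null_borel[OF F A])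
    finally show "(\<integral>z. indicator A z * Re (F z) \<partial>circle) = 0" .
  qed (use iF in simp)
  moreover have "AE z in circle. Im (F z) = 0"
  proof (rule AE_zero_of_set_integrals)
    fix A assume "A \<in> sets circle"
    then have A: "A \<in> sets borel" by (simp add: sets_circle)
    have "(\<integral>z. indicator A z * Im (F z) \<partial>circle) = (\<integral>z. Im (indicator A z * F z) \<partial>circle)"
      by (intro Bochner_Integration.integral_cong) (auto split: split_indicator)
    also have "\<dots> = 0" by (subst integral_Im[OF int[OF A]]) (simp add: fourier_null_borel[OF F A])
    finally show "(\<integral>z. indicator A z * Im (F z) \<partial>circle) = 0" .
  qed (use iF in simp)
  ultimately show ?thesis by eventually_elim (simp add: complex_eq_iff)
qed

lemma monomials_complete:
  assumes "\<And>k. cinner f (monomial k) = 0"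
  shows "f = 0"
proof -
  obtain F where F: "f = abs_L2 F" "square_integrable F" by (rule L2_cases)
  then have "fourier_null F"
    using assms
    by (simp add: fourier_null_def fourier_coeff_def monomial.abs_eq cinner_abs_L2 square_integrable_powi
      del: complex_cnj_power_int)
  then have "AE z in circle. F z = 0" by (rule fourier_null_AE_zero)
  then show ?thesis
    using F by (simp add: zero_L2.abs_eq abs_L2_eq_iff square_integrable_zero)
qed

section \<open>Hardy and model spaces\<close>

lemma H2_eq: "H2 = {f. \<forall>y\<in>monomial ` {..<0}. cinner f y = 0}"
  by (auto simp: H2_def fourier_coeff_eq_cinner)

lemma closed_csubspace_H2: "closed_csubspace H2"
  unfolding H2_eq by (rule closed_csubspace_orthogonal)

lemma monomial_in_H2: "0 \<le> k \<Longrightarrow> monomial k \<in> H2"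
  by (auto simp: H2_eq cinner_monomial)

text \<open>\<open>H2\<close> is the closed span of the monomials of nonnegative index: the
  remainder of f after projection is orthogonal to these because they lie in the subspace, and to
  the others because it lies in \<open>H2\<close>. Completeness makes it zero.\<close>

lemma H2_subset_closed_csubspace:
  assumes M: "closed_csubspace M" and mono: "\<And>k. 0 \<le> k \<Longrightarrow> monomial k \<in> M"
  shows "H2 \<subseteq> M"
proof
  fix f assume f: "f \<in> H2"
  \<comment> \<open>Intersecting with \<open>H2\<close> keeps the remainder of the projection in
    \<open>H2\<close>.\<close>
  let ?N = "M \<inter> H2"
  have N: "closed_csubspace ?N" using M closed_csubspace_H2 by (rule closed_csubspace_Int)
  have "f - orth_proj ?N f = 0"
  proof (rule monomials_complete)
    fix k :: int
    show "cinner (f - orth_proj ?N f) (monomial k) = 0"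
    proof (cases "0 \<le> k")
      case True
      then show ?thesis using mono monomial_in_H2 by (intro orth_proj_orthogonal[OF N]) auto
    next
      case False
      have "f - orth_proj ?N f \<in> H2"
        using f orth_proj_in[OF N] by (intro closed_csubspaceD[OF closed_csubspace_H2]) auto
      then show ?thesis using False by (auto simp: H2_eq)
    qed
  qed
  then show "f \<in> M" using orth_proj_in[OF N, of f] by simp
qed

text \<open>By the adjoint, the f with g f in \<open>H2\<close> form a closed subspace. It contains
  the monomials of nonnegative index since g has no Fourier coefficients of negative index.\<close>

lemma mult_L2_Hinf:
  assumes g: "g \<in> Hinf" and f: "f \<in> H2"
  shows "mult_L2 g f \<in> H2"
proof -
  have gL: "g \<in> Linf" and g0: "\<And>k. k < 0 \<Longrightarrow> fourier_coeff g k = 0" using g by (auto simp: Hinf_def)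
  let ?Y = "(\<lambda>k. mult_L2 (\<lambda>z. cnj (g z)) (monomial k)) ` {..<0}"
  have "H2 \<subseteq> {f. \<forall>y\<in>?Y. cinner f y = 0}"
  proof (rule H2_subset_closed_csubspace[OF closed_csubspace_orthogonal])
    fix k :: int assume "0 \<le> k"
    then show "monomial k \<in> {f. \<forall>y\<in>?Y. cinner f y = 0}"
      by (auto simp: cinner_mult_L2_monomial[OF gL] g0 simp flip: cinner_mult_L2[OF gL])
  qed
  with f show ?thesis by (auto simp: H2_eq cinner_mult_L2[OF gL])
qed

lemma closed_csubspace_model_space:
  assumes "\<theta> \<in> Linf"
  shows "closed_csubspace (model_space \<theta>)"
proof -
  have eq: "model_space \<theta> = H2 \<inter> {f. \<forall>y\<in>mult_L2 \<theta> ` H2. cinner f y = 0}"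
    by (auto simp: model_space_def)
  show ?thesis
    unfolding eq by (intro closed_csubspace_Int closed_csubspace_H2 closed_csubspace_orthogonal)
qed

section \<open>Block vectors and block matrices\<close>

text \<open>Vectors indexed by \<open>'n + 'n\<close> stand for pairs of vectors indexed by
  \<open>'n\<close>; \<open>join_halves\<close> and the two halves are the identification.\<close>

definition left_half :: "'a ^ ('n + 'n) \<Rightarrow> 'a ^ 'n::finite" where
  "left_half x = (\<chi> i. x $ Inl i)"

definition right_half :: "'a ^ ('n + 'n) \<Rightarrow> 'a ^ 'n::finite" where
  "right_half x = (\<chi> i. x $ Inr i)"

definition join_halves :: "'a ^ 'n \<Rightarrow> 'a ^ 'n \<Rightarrow> 'a ^ ('n::finite + 'n)" where
  "join_halves u v = (\<chi> i. case i of Inl j \<Rightarrow> u $ j | Inr j \<Rightarrow> v $ j)"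

lemma left_half_join: "left_half (join_halves u v) = u"
  and right_half_join: "right_half (join_halves u v) = v"
  by (simp_all add: vec_eq_iff left_half_def right_half_def join_halves_def)

lemma join_halves_halves: "join_halves (left_half x) (right_half x) = x"
  by (auto simp: vec_eq_iff left_half_def right_half_def join_halves_def split: sum.split)

lemma join_halves_add: "join_halves u v + join_halves u' v' = join_halves (u + u') (v + v')"
  by (auto simp: vec_eq_iff join_halves_def split: sum.split)

lemma vec_power_halves:
  "x \<in> vec_power S \<longleftrightarrow> left_half x \<in> vec_power S \<and> right_half x \<in> vec_power S"
  by (auto simp: vec_power_def left_half_def right_half_def split_sum_all)

lemma vec_power_join: "join_halves u v \<in> vec_power S \<longleftrightarrow> u \<in> vec_power S \<and> v \<in> vec_power S"
  by (subst vec_power_halves) (simp add: left_half_join right_half_join)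

lemma bounded_clinear_left_half: "bounded_clinear (left_half :: 'a::complex_inner ^ ('n + 'n) \<Rightarrow> 'a ^ 'n::finite)"
  by (rule bounded_clinear_vecI) (simp add: left_half_def bounded_clinear_component)

lemma bounded_clinear_right_half: "bounded_clinear (right_half :: 'a::complex_inner ^ ('n + 'n) \<Rightarrow> 'a ^ 'n::finite)"
  by (rule bounded_clinear_vecI) (simp add: right_half_def bounded_clinear_component)

lemma bounded_clinear_join_halves:
  fixes A B :: "'b::complex_inner \<Rightarrow> 'a::complex_inner ^ 'n::finite"
  assumes "bounded_clinear A" "bounded_clinear B"
  shows "bounded_clinear (\<lambda>x. join_halves (A x) (B x))"
proof (rule bounded_clinear_vecI)
  fix i :: "'n + 'n"
  show "bounded_clinear (\<lambda>x. join_halves (A x) (B x) $ i)"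
    by (cases i) (auto simp: join_halves_def
        intro!: bounded_clinear_compose[OF bounded_clinear_component] assms)
qed

lemma bounded_clinear_map_vec:
  assumes "bounded_clinear T"
  shows "bounded_clinear (\<lambda>x. \<chi> i::'n::finite. T (x $ i))"
  by (rule bounded_clinear_vecI) (simp add: bounded_clinear_compose[OF assms bounded_clinear_component])

lemma bounded_clinear_mult_matrix_L2:
  fixes G :: "complex \<Rightarrow> complex ^ 'n::finite ^ 'm::finite"
  assumes "G \<in> Linf_matrix"
  shows "bounded_clinear (mult_matrix_L2 G)"
  unfolding mult_matrix_L2_def
  by (rule bounded_clinear_vecI, simp)
    (intro bounded_clinear_sum bounded_clinear_compose[OF bounded_clinear_mult_L2 bounded_clinear_component],
      use assms in \<open>simp add: Linf_matrix_def\<close>)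

lemma sum_UNIV_halves:
  fixes f :: "'n::finite + 'n \<Rightarrow> 'a::comm_monoid_add"
  shows "(\<Sum>j\<in>UNIV. f j) = (\<Sum>j\<in>UNIV. f (Inl j)) + (\<Sum>j\<in>UNIV. f (Inr j))"
  by (simp add: UNIV_Plus_UNIV[symmetric] sum.Plus del: UNIV_Plus_UNIV)

lemma sum_mult_L2_mat:
  "(\<Sum>j\<in>UNIV. mult_L2 (\<lambda>z. mat (a z) $ i $ j) (x j)) = mult_L2 a (x (i::'n::finite))"
proof -
  have "mult_L2 (\<lambda>z. mat (a z) $ i $ j) (x j) = (if j = i then mult_L2 a (x i) else 0)" for j
    by (auto simp: mat_def mult_L2_zero)
  then show ?thesis by simp
qed

lemma mult_block_matrix:
  fixes G :: "complex \<Rightarrow> complex ^ 'n::finite ^ 'n"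
  shows "mult_matrix_L2 (\<lambda>z. block_matrix (mat (a z)) 0 (G z) (mat (b z))) x
    = join_halves (\<chi> i. mult_L2 a (left_half x $ i))
        (mult_matrix_L2 G (left_half x) + (\<chi> i. mult_L2 b (right_half x $ i)))"
  by (auto simp: vec_eq_iff mult_matrix_L2_def join_halves_def block_matrix_def sum_UNIV_halves
      left_half_def right_half_def sum_mult_L2_mat mult_L2_zero split: sum.split)

lemma toeplitz_eq: "toeplitz G x = orth_proj (vec_power H2) (mult_matrix_L2 G x)"
  by (simp add: toeplitz_def orth_proj_vec_power closed_csubspace_H2)

section \<open>Compression to the model space\<close>

locale inner_symbol =
  fixes \<theta> :: "complex \<Rightarrow> complex"
  assumes inner: "inner_function \<theta>"
begin

abbreviation "\<theta>' z \<equiv> cnj (\<theta> z)"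

lemma Linf: "\<theta> \<in> Linf" "\<theta>' \<in> Linf"
  using inner Linf_cnj by (auto simp: inner_function_def Hinf_def)

lemma mult_cancel: "mult_L2 \<theta>' (mult_L2 \<theta> x) = x"
proof (rule mult_L2_unimodular[OF Linf(2,1)])
  have "AE z in circle. cmod (\<theta> z) = 1" using inner by (simp add: inner_function_def)
  then show "AE z in circle. \<theta>' z * \<theta> z = 1"
    by eventually_elim (metis complex_norm_square mult.commute of_real_1 one_power2)
qed

lemma mult_in_H2: "x \<in> H2 \<Longrightarrow> mult_L2 \<theta> x \<in> H2"
  using inner by (simp add: inner_function_def mult_L2_Hinf)

lemma cinner_adjoint: "cinner (mult_L2 \<theta>' x) y = cinner x (mult_L2 \<theta> y)"
  using cinner_mult_L2[OF Linf(2)] by simp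

text \<open>Multiplication by \<theta> preserves \<open>H2\<close>, so its adjoint preserves the
  orthogonal complement, where x minus its projection lies.\<close>

lemma proj_adjoint_proj:
  "orth_proj H2 (mult_L2 \<theta>' (orth_proj H2 x)) = orth_proj H2 (mult_L2 \<theta>' x)"
proof -
  have "orth_proj H2 (mult_L2 \<theta>' (x - orth_proj H2 x)) = 0"
    by (intro orth_proj_eq_zero[OF closed_csubspace_H2])
      (simp add: cinner_adjoint orth_proj_orthogonal[OF closed_csubspace_H2] mult_in_H2)
  then show ?thesis
    by (simp add: bounded_clinear_diff_eq[OF bounded_clinear_mult_L2[OF Linf(2)]]
        bounded_clinear_diff_eq[OF bounded_clinear_orth_proj[OF closed_csubspace_H2]])
qed

text \<open>Moving the multiplication to the other side turns orthogonality of
  \<open>\<theta>' x\<close> to \<open>H2\<close> into orthogonality of x to \<theta>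
  \<open>H2\<close>.\<close>

lemma proj_adjoint_model_space: "x \<in> model_space \<theta> \<Longrightarrow> orth_proj H2 (mult_L2 \<theta>' x) = 0"
  by (intro orth_proj_eq_zero[OF closed_csubspace_H2]) (simp add: cinner_adjoint model_space_def)

text \<open>The subtracted term is the projection of x onto \<theta> \<open>H2\<close>, the part of
  \<open>H2\<close> that is split off to form the model space.\<close>

lemma proj_model_space:
  "orth_proj (model_space \<theta>) x = orth_proj H2 x - mult_L2 \<theta> (orth_proj H2 (mult_L2 \<theta>' x))"
proof (rule orth_proj_eqI[OF closed_csubspace_model_space[OF Linf(1)]])
  let ?P = "orth_proj H2"
  let ?y = "?P x - mult_L2 \<theta> (?P (mult_L2 \<theta>' x))"
  note P = orth_proj_in[OF closed_csubspace_H2] orth_proj_orthogonal[OF closed_csubspace_H2]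
  have "cinner ?y (mult_L2 \<theta> h) = 0" if "h \<in> H2" for h
  proof -
    have "cinner ?y (mult_L2 \<theta> h) = cinner (mult_L2 \<theta>' (?P x) - ?P (mult_L2 \<theta>' (?P x))) h"
      by (simp add: cinner_diff_left proj_adjoint_proj mult_cancel
          bounded_clinear_diff_eq[OF bounded_clinear_mult_L2[OF Linf(2)]] flip: cinner_adjoint)
    then show ?thesis using P that by simp
  qed
  then show "?y \<in> model_space \<theta>"
    using closed_csubspaceD(5)[OF closed_csubspace_H2] P mult_in_H2 by (simp add: model_space_def)
  show "cinner (x - ?y) z = 0" if "z \<in> model_space \<theta>" for z
  proof -
    have z: "z \<in> H2" using that by (simp add: model_space_def)
    have "cinner z (mult_L2 \<theta> (?P (mult_L2 \<theta>' x))) = 0"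
      using that P by (simp add: model_space_def)
    then have "cinner (mult_L2 \<theta> (?P (mult_L2 \<theta>' x))) z = 0"
      by (subst cinner_commute) simp
    then show ?thesis
      using P(2)[OF z, of x] by (simp add: cinner_diff_left)
  qed
qed

end

theorem theorem3p2:
  fixes \<theta> :: "complex \<Rightarrow> complex"
    and G :: "complex \<Rightarrow> complex ^ 'n::finite ^ 'n"
  assumes "inner_function \<theta>"
    and "G \<in> Linf_matrix"
  shows "equivalent_after_extension TYPE(L2 ^ ('n + 'n))
    (subspace_structure (vec_power (model_space \<theta>)))
    (subspace_structure (vec_power (model_space \<theta>)))
    (truncated_toeplitz \<theta> G)
    (subspace_structure (vec_power H2))
    (subspace_structure (vec_power H2))
    (toeplitz (\<lambda>z. block_matrix (mat (cnj (\<theta> z))) 0 (G z) (mat (\<theta> z))))"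
proof -
  interpret inner_symbol \<theta> by standard fact
  let ?H = "vec_power H2 :: (L2 ^ 'n) set"
  let ?HH = "vec_power H2 :: (L2 ^ ('n + 'n)) set"
  let ?K = "vec_power (model_space \<theta>) :: (L2 ^ 'n) set"
  define P where "P = orth_proj ?H"
  define Q where "Q = orth_proj ?K"
  define M where "M x = (\<chi> i. mult_L2 \<theta> (x $ i))" for x :: "L2 ^ 'n"
  define M' where "M' x = (\<chi> i. mult_L2 \<theta>' (x $ i))" for x :: "L2 ^ 'n"
  define A where "A = mult_matrix_L2 G"
  define S where "S = toeplitz (\<lambda>z. block_matrix (mat (cnj (\<theta> z))) 0 (G z) (mat (\<theta> z)))"
  note closed = closed_csubspace_H2 closed_csubspace_model_space[OF Linf(1)]
  have cH: "closed_csubspace ?H" and cK: "closed_csubspace ?K" and cHH: "closed_csubspace ?HH"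
    by (intro closed_csubspace_vec_power closed)+
  have c0: "closed_csubspace {0 :: L2 ^ ('n + 'n)}"
    by (simp add: closed_csubspace_def scaleC_zero_right)

  have P: "bounded_clinear P" and Q: "bounded_clinear Q" and M: "bounded_clinear M"
    and M': "bounded_clinear M'" and A: "bounded_clinear A"
    unfolding P_def Q_def M_def M'_def A_def using assms(2)
    by (intro bounded_clinear_orth_proj cH cK bounded_clinear_map_vec bounded_clinear_mult_L2 Linf
        bounded_clinear_mult_matrix_L2)+
  note L = bounded_clinear_left_half bounded_clinear_right_half
  note lin = bounded_clinear_add_eq[OF P] bounded_clinear_add_eq[OF Q] bounded_clinear_add_eq[OF M]
    bounded_clinear_add_eq[OF M'] bounded_clinear_add_eq[OF A] bounded_clinear_diff_eq[OF P]
    bounded_clinear_diff_eq[OF Q] bounded_clinear_diff_eq[OF M] bounded_clinear_diff_eq[OF M']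
    bounded_clinear_add_eq[OF L(1)] bounded_clinear_add_eq[OF L(2)]
  note bc = P[THEN bounded_clinear_compose] Q[THEN bounded_clinear_compose]
    M[THEN bounded_clinear_compose] M'[THEN bounded_clinear_compose]
    A[THEN bounded_clinear_compose] L bounded_clinear_zero bounded_clinear_ident
    bounded_clinear_add bounded_clinear_diff bounded_clinear_uminus bounded_clinear_join_halves

  \<comment> \<open>Relations between the projections and multiplication by \<theta>\<close>
  have P_vec: "P x = (\<chi> i. orth_proj H2 (x $ i))" for x
    by (simp add: P_def orth_proj_vec_power closed)
  have Q_vec: "Q x = (\<chi> i. orth_proj (model_space \<theta>) (x $ i))" for x
    by (simp add: Q_def orth_proj_vec_power closed)
  have M'M: "M' (M x) = x" for x
    by (simp add: M_def M'_def mult_cancel)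
  have PM'P: "P (M' (P x)) = P (M' x)" for x
    by (simp add: P_vec M'_def proj_adjoint_proj)
  have PM'K: "P (M' k) = 0" if "k \<in> ?K" for k
    using that by (simp add: P_vec M'_def vec_power_def proj_adjoint_model_space vec_eq_iff)
  have Q_eq: "Q x = P x - M (P (M' x))" for x
    by (simp add: Q_vec P_vec M_def M'_def proj_model_space vec_eq_iff)
  have KH: "k \<in> ?H" if "k \<in> ?K" for k
    using that by (simp add: vec_power_def model_space_def)
  have PH: "P x \<in> ?H" and QK: "Q x \<in> ?K" for x
    unfolding P_def Q_def by (intro orth_proj_in cH cK)+
  have P_id: "P x = x" if "x \<in> ?H" for x
    unfolding P_def using that by (rule orth_proj_ident[OF cH])
  have Q_id: "Q x = x" if "x \<in> ?K" for x
    unfolding Q_def using that by (rule orth_proj_ident[OF cK])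
  have MH: "M x \<in> ?H" if "x \<in> ?H" for x
    using that by (simp add: M_def vec_power_def mult_in_H2)
  have QM: "Q (M x) = 0" if "x \<in> ?H" for x
    using that by (simp add: Q_eq M'M P_id MH)
  note H_add = closed_csubspaceD(2)[OF cH] and H_diff = closed_csubspaceD(5)[OF cH]
  have halves: "left_half x \<in> ?H" "right_half x \<in> ?H" if "x \<in> ?HH" for x
    using that by (simp_all add: vec_power_halves)
  have S_eq: "S x = join_halves (P (M' (left_half x))) (P (A (left_half x)) + P (M (right_half x)))" for x
    unfolding S_def toeplitz_eq mult_block_matrix
    by (simp add: orth_proj_vec_power closed P_vec M_def M'_def A_def vec_eq_iff join_halves_def
        bounded_clinear_add_eq[OF bounded_clinear_orth_proj[OF closed_csubspace_H2]] split: sum.split)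

  \<comment> \<open>The spaces and the operators of the equivalence\<close>
  define X where "X = subspace_structure ?K"
  define Y where "Y = subspace_structure ?HH"
  \<comment> \<open>Both extension spaces must take their points from one type. Hence
    \<open>Y\<close> itself serves as \<open>X\<^sub>0\<close>, with pairs encoded as joined halves,
    and its zero subspace \<open>Z\<close> as \<open>Y\<^sub>0\<close>.\<close>
  define Z where "Z = subspace_structure {0 :: L2 ^ ('n + 'n)}"
  \<comment> \<open>This is the vector c of the overview.\<close>
  define b where "b y = right_half y - P (A (M (left_half y)))" for y
  define E where "E = (\<lambda>(y, _ :: L2 ^ ('n + 'n)). (Q (b y), join_halves (left_half y) (P (M' (b y)))))"
  \<comment> \<open>To invert \<open>E\<close>, with h and w the halves of x, c is recovered as k +
    \<theta> w from its two parts, and the second component as c + P G \<theta> h.\<close>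
  define E' where "E' = (\<lambda>(k, x). (join_halves 0 k
    + join_halves (left_half x) (M (right_half x) + P (A (M (left_half x)))), 0 :: L2 ^ ('n + 'n)))"
  define F where "F = (\<lambda>(k, x). (join_halves k (- P (M' (A k)))
    + join_halves (M (left_half x)) (right_half x), 0 :: L2 ^ ('n + 'n)))"
  \<comment> \<open>To invert \<open>F\<close>, the first half is split into its components in K and
    \<theta> H; the K component then determines the correction to be added back.\<close>
  define F' where "F' = (\<lambda>(y, _ :: L2 ^ ('n + 'n)). (Q (left_half y),
    join_halves (P (M' (left_half y))) (right_half y + P (M' (A (Q (left_half y)))))))"

  \<comment> \<open>Invertibility of \<open>E\<close>\<close>
  have b_H: "b y \<in> ?H" if "y \<in> ?HH" for y
    unfolding b_def using that by (intro H_diff halves PH)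
  have bb: "bounded_clinear b" unfolding b_def by (intro bc)
  \<comment> \<open>The two shapes that occur: maps out of the sum of \<open>Y\<close> and
    \<open>Z\<close>, with zero second column, and maps into it, with zero second row.\<close>
  note bounded = bounded_operator_direct_sum[OF _ bounded_clinear_zero _ bounded_clinear_zero, simplified]
    bounded_operator_direct_sum[OF _ _ bounded_clinear_zero bounded_clinear_zero, simplified]
  have "bounded_operator (Y \<oplus>\<^sub>B Z) (X \<oplus>\<^sub>B Y) E"
    unfolding X_def Y_def Z_def E_def
    by (rule bounded(1)) (auto intro!: bc bb[THEN bounded_clinear_compose] bb simp: vec_power_join QK PH halves)
  moreover have "bounded_operator (X \<oplus>\<^sub>B Y) (Y \<oplus>\<^sub>B Z) E'"
    unfolding X_def Y_def Z_def E'_def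
    by (rule bounded(2)) (auto intro!: bc H_add MH simp: join_halves_add vec_power_join PH halves KH)
  moreover have "E' (E p) = p" if mem: "p \<in> vcarrier (Y \<oplus>\<^sub>B Z)" for p
  proof -
    obtain y where p: "p = (y, 0)" and y: "y \<in> ?HH"
      using mem by (auto simp: direct_sum_def subspace_structure_def Y_def Z_def)
    \<comment> \<open>The decomposition H = K \<oplus> \<theta> H, applied to
      \<open>b y\<close>.\<close>
    have "Q (b y) + M (P (M' (b y))) = b y" using P_id[OF b_H[OF y]] by (simp add: Q_eq)
    then have "Q (b y) + (M (P (M' (b y))) + P (A (M (left_half y)))) = right_half y"
      by (simp add: b_def flip: add.assoc)
    then show ?thesis
      by (simp add: p E_def E'_def join_halves_add left_half_join right_half_join join_halves_halves)
  qed
  moreover have "E (E' q) = q" if mem: "q \<in> vcarrier (X \<oplus>\<^sub>B Y)" for q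
  proof -
    obtain k x where q: "q = (k, x)" and k: "k \<in> ?K" and x: "x \<in> ?HH"
      using mem by (auto simp: direct_sum_def subspace_structure_def X_def Y_def)
    \<comment> \<open>Here \<open>b\<close> yields k + \<theta> w with w the right half of x; Q
      annihilates \<theta> w and \<open>P M'\<close> annihilates k.\<close>
    show ?thesis
      by (simp add: q E_def E'_def b_def join_halves_add left_half_join right_half_join lin
          Q_id[OF k] QM PM'K[OF k] M'M P_id halves[OF x] join_halves_halves)
  qed
  ultimately have E: "invertible_operator (Y \<oplus>\<^sub>B Z) (X \<oplus>\<^sub>B Y) E"
    by (auto simp: invertible_operator_def)

  \<comment> \<open>Invertibility of \<open>F\<close>\<close>
  have "bounded_operator (X \<oplus>\<^sub>B Y) (Y \<oplus>\<^sub>B Z) F"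
    unfolding X_def Y_def Z_def F_def
    by (rule bounded(2)) (auto intro!: bc H_add H_diff MH simp: join_halves_add vec_power_join PH halves KH)
  moreover have "bounded_operator (Y \<oplus>\<^sub>B Z) (X \<oplus>\<^sub>B Y) F'"
    unfolding X_def Y_def Z_def F'_def
    by (rule bounded(1)) (auto intro!: bc H_add simp: vec_power_join QK PH halves)
  moreover have "F' (F p) = p" if mem: "p \<in> vcarrier (X \<oplus>\<^sub>B Y)" for p
  proof -
    obtain k x where p: "p = (k, x)" and k: "k \<in> ?K" and x: "x \<in> ?HH"
      using mem by (auto simp: direct_sum_def subspace_structure_def X_def Y_def)
    show ?thesis
      by (simp add: p F_def F'_def join_halves_add left_half_join right_half_join lin
          Q_id[OF k] QM PM'K[OF k] M'M P_id halves[OF x] join_halves_halves)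
  qed
  moreover have "F (F' q) = q" if mem: "q \<in> vcarrier (Y \<oplus>\<^sub>B Z)" for q
  proof -
    obtain y where q: "q = (y, 0)" and y: "y \<in> ?HH"
      using mem by (auto simp: direct_sum_def subspace_structure_def Y_def Z_def)
    have "Q (left_half y) + M (P (M' (left_half y))) = left_half y"
      using P_id[OF halves(1)[OF y]] by (simp add: Q_eq)
    then show ?thesis
      by (simp add: q F_def F'_def join_halves_add left_half_join right_half_join join_halves_halves)
  qed
  ultimately have F: "invertible_operator (X \<oplus>\<^sub>B Y) (Y \<oplus>\<^sub>B Z) F"
    by (auto simp: invertible_operator_def)

  \<comment> \<open>The factorization through the Toeplitz operator\<close>
  have T_eq: "truncated_toeplitz \<theta> G = (\<lambda>x. Q (A x))"
    by (simp add: fun_eq_iff truncated_toeplitz_def Q_def A_def)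
  have factor: "map_prod (truncated_toeplitz \<theta> G) id p = E (map_prod S id (F p))"
    if mem: "p \<in> vcarrier (X \<oplus>\<^sub>B Y)" for p
  proof -
    obtain k x where p: "p = (k, x)" and k: "k \<in> ?K" and x: "x \<in> ?HH"
      using mem by (auto simp: direct_sum_def subspace_structure_def X_def Y_def)
    let ?h = "left_half x" and ?w = "right_half x"
    let ?y = "S (fst (F p))"
    have left: "left_half ?y = ?h"
      by (simp add: p F_def S_eq join_halves_add left_half_join lin PM'K[OF k] M'M P_id halves[OF x])
    \<comment> \<open>The vector w - P \<open>\<theta>'\<close> G k lies in H, and so does its
      product with \<theta>, which P therefore fixes.\<close>
    have "right_half ?y = P (A k) + P (A (M ?h)) + M (?w - P (M' (A k)))"
      using P_id[OF MH[OF H_diff[OF halves(2)[OF x] PH[of "M' (A k)"]]]]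
      by (simp add: p F_def S_eq join_halves_add left_half_join right_half_join lin)
    \<comment> \<open>The correction built into \<open>F\<close> pays off: P G k - \<theta> P
      \<open>\<theta>'\<close> G k is Q G k.\<close>
    then have b: "b ?y = Q (A k) + M ?w"
      by (simp add: b_def left Q_eq lin)
    have "Q (b ?y) = Q (A k)" "P (M' (b ?y)) = ?w"
      by (simp_all add: b lin Q_id[OF QK] QM PM'K[OF QK] M'M P_id halves[OF x])
    then have "E (?y, 0) = map_prod (truncated_toeplitz \<theta> G) id p"
      by (simp add: E_def left T_eq) (simp add: p join_halves_halves)
    moreover have "map_prod S id (F p) = (?y, 0)"
      by (simp add: p F_def)
    ultimately show ?thesis by simp
  qed

  \<comment> \<open>Completeness of the spaces and boundedness of both operators\<close>
  have banach: "complex_banach_space X" "complex_banach_space Y" "complex_banach_space Z"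
    unfolding X_def Y_def Z_def by (intro complex_banach_space_subspace cK cHH c0)+
  have "bounded_operator X X (truncated_toeplitz \<theta> G)"
    unfolding X_def T_eq by (intro bounded_operator_subspace bc A QK)
  moreover have "bounded_operator Y Y S"
    unfolding Y_def by (rule bounded_operator_subspace)
      (auto simp: S_eq[abs_def] vec_power_join intro!: bc H_add PH)
  ultimately have "equivalent_after_extension TYPE(L2 ^ ('n + 'n)) X X (truncated_toeplitz \<theta> G) Y Y S"
    unfolding equivalent_after_extension_def using banach E F factor by blast
  then show ?thesis by (simp only: X_def Y_def S_def)
qed

end
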